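(* For every $\eta >0$ there exists $c>0$ for which the following holds. Let $\ell$ and $n$ be integers such that $\ell \geq c \cdot \log_2 n$, and let $g: \{0,1\}^\ell \times \{0,1\}^\ell \rightarrow \{0,1\}$ be a function satisfying $\mathrm{disc}(g) \leq 2^{-\eta \cdot \ell}$. Then, for every function $f : \{0,1\}^n \rightarrow \{0,1\}$, it holds that \[\mathsf{coNP^{cc}} ( f \circ g^n) \geq \Omega \big ( \eta \cdot \mathsf{C}_0(f) \cdot \ell \big ).\]
   Context: The notation $\Omega(\cdot)$ hides an absolute positive multiplicative constant. Composition: for $x=(x_1,\ldots,x_n),y=(y_1,\ldots,y_n)\in\{0,1\}^{\ell \cdot n}$, viewed as concatenations of $n$ blocks of size $\ell$, $g^n(x,y)=(g(x_1,y_1),\ldots,g(x_n,y_n))\in\{0,1\}^n$, and the composed function $f\circ g^n:\{0,1\}^{\ell\cdot n}\times\{0,1\}^{\ell\cdot n}\to\{0,1\}$ is defined by $(f\circ g^n)(x,y)=f(g^n(x,y))$. Discrepancy (with respect to the uniform distribution): let $\Lambda=\{0,1\}^\ell$ and let $X,Y$ be independent random variables uniformly distributed over $\Lambda$. For a combinatorial rectangle $R=A\times B\subseteq\Lambda\times\Lambda$, $\mathrm{disc}_R(g)=\big|\Pr[g(X,Y)=0\text{ and }(X,Y)\in R]-\Pr[g(X,Y)=1\text{ and }(X,Y)\in R]\big|$, and $\mathrm{disc}(g)$ is the maximum of $\mathrm{disc}_R(g)$ over all combinatorial rectangles $R\subseteq\Lambda\times\Lambda$. Communication complexity: let $\Lambda'$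 be a finite set and $F:\Lambda'\times\Lambda'\to\{0,1\}$ a function; one player holds $x\in\Lambda'$ and another holds $y\in\Lambda'$. The non-deterministic communication complexity of $F$ is the smallest possible number of communicated bits (in the worst case) in a non-deterministic communication protocol for $F$, that is, a protocol satisfying that $F(x,y)=1$ if and only if there exists an accepting computation on $(x,y)$. The co-non-deterministic communication complexity $\mathsf{coNP^{cc}}(F)$ is the non-deterministic communication complexity of the negation $\neg F=1-F$. If $M=(F(x,y))_{x,y\in\Lambda'}$ is the matrix associated with $F$ and $\overline{M}$ is its complement (zeros and ones exchanged), then $\mathsf{coNP^{cc}}(F)=\lceil\log_2 \mathrm{rank}_{\mathbb{B}}(\overline{M})\rceil$, where the Boolean rank $\mathrm{rank}_{\mathbb{B}}(N)$ of a $0,1$ matrix $N$ is the smallest number of combinatorial rectangles (sets of the form rows $\times$ columns) consisting only of ones of $N$ that cover the ones of $N$. Certificate complexity: a $k$-DNF formula on $n$ variables is a Boolean formula that can be written as a disjunction $c_1\vee\cdots\vee c_m$, where every $c_i$ is a conjunction of at most $k$ literals. $\mathsf{C}_1(f)$ is the smallest integer $k$ for which $f$ can be written as a $k$-DNF formula, and $\mathsf{C}_0(f)=\mathsf{C}_1(\neg f)$, where $\neg f$ is the negation of $f$.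
   Formalization: The theorem assumes n ≥ 2; for n = 1 the claim fails as written (η = 1, ℓ = 1, g(x,y) = x, f the identity: disc(g) = 1/2, C_0(f) = 1, but coNP^cc = 0), while n = 1 with ℓ ≥ c follows from n = 2 by adding a dummy variable. *)

theory Defs
  imports "HOL-Probability.Probability"
begin

definition bits :: "nat \<Rightarrow> bool list set" where
  "bits n = {x. length x = n}"

definition block :: "nat \<Rightarrow> nat \<Rightarrow> bool list \<Rightarrow> bool list" where
  "block l i x = take l (drop (i * l) x)"

definition gadget_pow ::
    "nat \<Rightarrow> nat \<Rightarrow> (bool list \<Rightarrow> bool list \<Rightarrow> bool) \<Rightarrow> bool list \<Rightarrow> bool list \<Rightarrow> bool list" where
  "gadget_pow l n g x y = map (\<lambda>i. g (block l i x) (block l i y)) [0..<n]"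

definition block_compose ::
    "nat \<Rightarrow> nat \<Rightarrow> (bool list \<Rightarrow> bool) \<Rightarrow> (bool list \<Rightarrow> bool list \<Rightarrow> bool)
      \<Rightarrow> bool list \<Rightarrow> bool list \<Rightarrow> bool" where
  "block_compose l n f g x y = f (gadget_pow l n g x y)"


section \<open>Discrepancy\<close>

definition disc_rect :: "'a set \<Rightarrow> ('a \<Rightarrow> 'a \<Rightarrow> bool) \<Rightarrow> 'a set \<Rightarrow> 'a set \<Rightarrow> real" where
  "disc_rect L g A B =
    (let XY = pair_pmf (pmf_of_set L) (pmf_of_set L) in
      \<bar>measure_pmf.prob XY {(x, y). \<not> g x y \<and> (x, y) \<in> A \<times> B}
       - measure_pmf.prob XY {(x, y). g x y \<and> (x, y) \<in> A \<times> B}\<bar>)"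

definition disc :: "'a set \<Rightarrow> ('a \<Rightarrow> 'a \<Rightarrow> bool) \<Rightarrow> real" where
  "disc L g = Max {disc_rect L g A B | A B. A \<subseteq> L \<and> B \<subseteq> L}"


section \<open>Non-deterministic communication complexity\<close>

text \<open>
  A protocol is a binary tree. At an inner node one player sends a bit, chosen
  non-deterministically from the set of bits that its own input permits there (a stuck
  computation does not accept). When the communication ends, a computation is accepting if each
  player accepts, on the basis of its own input and the transcript. With this convention the
  complexity is exactly the rounded-up logarithm of the Boolean rank (lemma \<open>coNPcc_bool_rank\<close>
  below); letting the transcript alone decide would cost one more bit in some cases.
\<close>

datatype 'a protocol =
    Halt "'a \<Rightarrow> bool" "'a \<Rightarrow> bool"
  | Alice "'a \<Rightarrow> bool set" "'a protocol" "'a protocol"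
  | Bob "'a \<Rightarrow> bool set" "'a protocol" "'a protocol"

primrec has_accepting :: "'a protocol \<Rightarrow> 'a \<Rightarrow> 'a \<Rightarrow> bool" where
  "has_accepting (Halt a b) x y \<longleftrightarrow> a x \<and> b y"
| "has_accepting (Alice s P0 P1) x y \<longleftrightarrow>
    (False \<in> s x \<and> has_accepting P0 x y) \<or> (True \<in> s x \<and> has_accepting P1 x y)"
| "has_accepting (Bob s P0 P1) x y \<longleftrightarrow>
    (False \<in> s y \<and> has_accepting P0 x y) \<or> (True \<in> s y \<and> has_accepting P1 x y)"

primrec cost :: "'a protocol \<Rightarrow> nat" where
  "cost (Halt a b) = 0"
| "cost (Alice s P0 P1) = Suc (max (cost P0) (cost P1))"
| "cost (Bob s P0 P1) = Suc (max (cost P0) (cost P1))"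

definition protocol_for :: "'a set \<Rightarrow> ('a \<Rightarrow> 'a \<Rightarrow> bool) \<Rightarrow> 'a protocol \<Rightarrow> bool" where
  "protocol_for L F P \<longleftrightarrow> (\<forall>x\<in>L. \<forall>y\<in>L. F x y \<longleftrightarrow> has_accepting P x y)"

definition NPcc :: "'a set \<Rightarrow> ('a \<Rightarrow> 'a \<Rightarrow> bool) \<Rightarrow> nat" where
  "NPcc L F = (LEAST k. \<exists>P. protocol_for L F P \<and> cost P = k)"

definition coNPcc :: "'a set \<Rightarrow> ('a \<Rightarrow> 'a \<Rightarrow> bool) \<Rightarrow> nat" where
  "coNPcc L F = NPcc L (\<lambda>x y. \<not> F x y)"

definition ones :: "'a set \<Rightarrow> ('a \<Rightarrow> 'a \<Rightarrow> bool) \<Rightarrow> ('a \<times> 'a) set" where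
  "ones L N = {(x, y). x \<in> L \<and> y \<in> L \<and> N x y}"

definition rect_cover :: "'a set \<Rightarrow> ('a \<Rightarrow> 'a \<Rightarrow> bool) \<Rightarrow> ('a \<times> 'a) set set \<Rightarrow> bool" where
  "rect_cover L N C \<longleftrightarrow>
    finite C \<and> (\<forall>R\<in>C. \<exists>A B. A \<subseteq> L \<and> B \<subseteq> L \<and> R = A \<times> B) \<and> \<Union>C = ones L N"

definition bool_rank :: "'a set \<Rightarrow> ('a \<Rightarrow> 'a \<Rightarrow> bool) \<Rightarrow> nat" where
  "bool_rank L N = (LEAST r. \<exists>C. rect_cover L N C \<and> card C = r)"

lemma rect_cover_restrict:
  assumes "rect_cover L N C" "S \<subseteq> L" "T \<subseteq> L"
  obtains D where "rect_cover L (\<lambda>x y. x \<in> S \<and> y \<in> T \<and> N x y) D" "card D \<le> card C"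
proof
  let ?D = "(\<lambda>R. R \<inter> S \<times> T) ` C"
  show "card ?D \<le> card C"
    using assms by (auto simp: rect_cover_def intro: card_image_le)
  have "\<exists>A B. A \<subseteq> L \<and> B \<subseteq> L \<and> R \<inter> S \<times> T = A \<times> B" if R: "R \<in> C" for R
  proof -
    obtain A B where "A \<subseteq> L" "B \<subseteq> L" "R = A \<times> B"
      using R assms(1) by (auto simp: rect_cover_def)
    then show ?thesis
      by (intro exI[of _ "A \<inter> S"] exI[of _ "B \<inter> T"]) auto
  qed
  moreover have "\<Union>?D = \<Union>C \<inter> S \<times> T"
    by auto
  ultimately show "rect_cover L (\<lambda>x y. x \<in> S \<and> y \<in> T \<and> N x y) ?D"
    using assms by (auto simp: rect_cover_def ones_def)
qed

lemma rect_cover_Un: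
  assumes "rect_cover L N C" "rect_cover L M D"
  shows "rect_cover L (\<lambda>x y. N x y \<or> M x y) (C \<union> D)"
  using assms by (auto simp: rect_cover_def ones_def)

lemma rect_cover_cong:
  assumes "rect_cover L N C" "\<And>x y. x \<in> L \<Longrightarrow> y \<in> L \<Longrightarrow> N x y \<longleftrightarrow> M x y"
  shows "rect_cover L M C"
proof -
  have "ones L N = ones L M"
    using assms(2) by (auto simp: ones_def)
  then show ?thesis
    using assms(1) by (simp add: rect_cover_def)
qed

lemma card_Un_le_double_power:
  assumes "card C \<le> 2 ^ a" "card D \<le> 2 ^ b"
  shows "card (C \<union> D) \<le> 2 ^ Suc (max a b)"
proof -
  have "card (C \<union> D) \<le> card C + card D"
    by (rule card_Un_le)
  also have "\<dots> \<le> 2 ^ max a b + 2 ^ max a b"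
  proof (rule add_mono)
    show "card C \<le> 2 ^ max a b"
      using assms(1) power_increasing[of a "max a b" "2::nat"] by linarith
    show "card D \<le> 2 ^ max a b"
      using assms(2) power_increasing[of b "max a b" "2::nat"] by linarith
  qed
  finally show ?thesis by simp
qed

lemma protocol_imp_rect_cover:
  "\<exists>C. rect_cover L (has_accepting P) C \<and> card C \<le> 2 ^ cost P"
proof (induction P)
  case (Halt a b)
  have "\<exists>A B. A \<subseteq> L \<and> B \<subseteq> L \<and> {x \<in> L. a x} \<times> {y \<in> L. b y} = A \<times> B"
    by (intro exI[of _ "{x \<in> L. a x}"] exI[of _ "{y \<in> L. b y}"]) auto
  then have "rect_cover L (has_accepting (Halt a b)) {{x \<in> L. a x} \<times> {y \<in> L. b y}}"
    by (auto simp: rect_cover_def ones_def)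
  then show ?case by (intro exI conjI, assumption) simp
next
  case (Alice s P0 P1)
  obtain C0 C1 where C: "rect_cover L (has_accepting P0) C0" "card C0 \<le> 2 ^ cost P0"
      "rect_cover L (has_accepting P1) C1" "card C1 \<le> 2 ^ cost P1"
    using Alice by blast
  obtain D0 where D0: "rect_cover L
      (\<lambda>x y. x \<in> {x \<in> L. False \<in> s x} \<and> y \<in> L \<and> has_accepting P0 x y) D0" "card D0 \<le> card C0"
    by (rule rect_cover_restrict[OF C(1), of "{x \<in> L. False \<in> s x}" L]) auto
  obtain D1 where D1: "rect_cover L
      (\<lambda>x y. x \<in> {x \<in> L. True \<in> s x} \<and> y \<in> L \<and> has_accepting P1 x y) D1" "card D1 \<le> card C1"
    by (rule rect_cover_restrict[OF C(3), of "{x \<in> L. True \<in> s x}" L]) auto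
  have "rect_cover L (has_accepting (Alice s P0 P1)) (D0 \<union> D1)"
    by (rule rect_cover_cong[OF rect_cover_Un[OF D0(1) D1(1)]]) auto
  moreover have "card (D0 \<union> D1) \<le> 2 ^ cost (Alice s P0 P1)"
    using card_Un_le_double_power[of D0 "cost P0" D1 "cost P1"] C D0 D1 by simp
  ultimately show ?case by blast
next
  case (Bob s P0 P1)
  obtain C0 C1 where C: "rect_cover L (has_accepting P0) C0" "card C0 \<le> 2 ^ cost P0"
      "rect_cover L (has_accepting P1) C1" "card C1 \<le> 2 ^ cost P1"
    using Bob by blast
  obtain D0 where D0: "rect_cover L
      (\<lambda>x y. x \<in> L \<and> y \<in> {y \<in> L. False \<in> s y} \<and> has_accepting P0 x y) D0" "card D0 \<le> card C0"
    by (rule rect_cover_restrict[OF C(1), of L "{x \<in> L. False \<in> s x}"]) auto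
  obtain D1 where D1: "rect_cover L
      (\<lambda>x y. x \<in> L \<and> y \<in> {y \<in> L. True \<in> s y} \<and> has_accepting P1 x y) D1" "card D1 \<le> card C1"
    by (rule rect_cover_restrict[OF C(3), of L "{x \<in> L. True \<in> s x}"]) auto
  have "rect_cover L (has_accepting (Bob s P0 P1)) (D0 \<union> D1)"
    by (rule rect_cover_cong[OF rect_cover_Un[OF D0(1) D1(1)]]) auto
  moreover have "card (D0 \<union> D1) \<le> 2 ^ cost (Bob s P0 P1)"
    using card_Un_le_double_power[of D0 "cost P0" D1 "cost P1"] C D0 D1 by simp
  ultimately show ?case by blast
qed

lemma rect_list_imp_protocol:
  assumes "length Rs \<le> 2 ^ k" "\<forall>R\<in>set Rs. \<exists>A B. R = A \<times> B"
  shows "\<exists>P. cost P = k \<and> (\<forall>x y. has_accepting P x y \<longleftrightarrow> (x, y) \<in> \<Union>(set Rs))"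
  using assms
proof (induction k arbitrary: Rs)
  case 0
  show ?case
  proof (cases Rs)
    case Nil
    then show ?thesis
      by (intro exI[of _ "Halt (\<lambda>_. False) (\<lambda>_. False)"]) simp
  next
    case (Cons R Rs')
    with 0 obtain A B where "Rs = [A \<times> B]"
      by fastforce
    then show ?thesis
      by (intro exI[of _ "Halt (\<lambda>x. x \<in> A) (\<lambda>y. y \<in> B)"]) simp
  qed
next
  case (Suc k)
  let ?Us = "take (2 ^ k) Rs" and ?Vs = "drop (2 ^ k) Rs"
  have split: "set Rs = set ?Us \<union> set ?Vs"
    by (metis append_take_drop_id set_append)
  have len: "length ?Us \<le> 2 ^ k" "length ?Vs \<le> 2 ^ k"
    using Suc.prems(1) by simp_all
  have rects: "\<forall>R\<in>set ?Us. \<exists>A B. R = A \<times> B" "\<forall>R\<in>set ?Vs. \<exists>A B. R = A \<times> B"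
    using Suc.prems(2) split by blast+
  obtain P0 where P0: "cost P0 = k"
      "\<forall>x y. has_accepting P0 x y \<longleftrightarrow> (x, y) \<in> \<Union>(set ?Us)"
    using Suc.IH[OF len(1) rects(1)] by blast
  obtain P1 where P1: "cost P1 = k"
      "\<forall>x y. has_accepting P1 x y \<longleftrightarrow> (x, y) \<in> \<Union>(set ?Vs)"
    using Suc.IH[OF len(2) rects(2)] by blast
  have "cost (Alice (\<lambda>_. UNIV) P0 P1) = Suc k"
    using P0 P1 by simp
  moreover have "has_accepting (Alice (\<lambda>_. UNIV) P0 P1) x y \<longleftrightarrow> (x, y) \<in> \<Union>(set Rs)" for x y
    unfolding split using P0 P1 by auto
  ultimately show ?case by blast
qed

lemma rect_cover_exists:
  assumes "finite L"
  shows "\<exists>C. rect_cover L N C"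
proof
  have "finite (ones L N)"
    by (rule finite_subset[of _ "L \<times> L"]) (use assms in \<open>auto simp: ones_def\<close>)
  moreover have "\<exists>A B. A \<subseteq> L \<and> B \<subseteq> L \<and> {p} = A \<times> B" if "p \<in> ones L N" for p
    using that by (intro exI[of _ "{fst p}"] exI[of _ "{snd p}"]) (auto simp: ones_def)
  ultimately show "rect_cover L N ((\<lambda>p. {p}) ` ones L N)"
    by (auto simp: rect_cover_def)
qed

lemma protocol_iff_bool_rank:
  assumes "finite L"
  shows "(\<exists>P. protocol_for L F P \<and> cost P = k) \<longleftrightarrow> bool_rank L F \<le> 2 ^ k"
proof
  assume "\<exists>P. protocol_for L F P \<and> cost P = k"
  then obtain P where P: "protocol_for L F P" "cost P = k"
    by blast
  obtain C where C: "rect_cover L (has_accepting P) C" "card C \<le> 2 ^ k"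
    using protocol_imp_rect_cover[of L P] P(2) by blast
  have "rect_cover L F C"
    by (rule rect_cover_cong[OF C(1)]) (use P(1) in \<open>auto simp: protocol_for_def\<close>)
  then have "bool_rank L F \<le> card C"
    unfolding bool_rank_def by (blast intro: Least_le)
  then show "bool_rank L F \<le> 2 ^ k"
    using C(2) by simp
next
  assume k: "bool_rank L F \<le> 2 ^ k"
  have "\<exists>C. rect_cover L F C \<and> card C = bool_rank L F"
    unfolding bool_rank_def by (rule LeastI_ex) (use rect_cover_exists[OF assms] in blast)
  then obtain C where C: "rect_cover L F C" "card C = bool_rank L F"
    by blast
  then obtain Rs where Rs: "set Rs = C" "length Rs = card C"
    using finite_distinct_list[of C] distinct_card by (metis rect_cover_def)
  obtain P where "cost P = k" "\<forall>x y. has_accepting P x y \<longleftrightarrow> (x, y) \<in> \<Union>(set Rs)"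
    using rect_list_imp_protocol[of Rs k] Rs C k by (metis rect_cover_def)
  then show "\<exists>P. protocol_for L F P \<and> cost P = k"
    using C Rs by (intro exI[of _ P]) (auto simp: protocol_for_def rect_cover_def ones_def)
qed

lemma coNPcc_bool_rank:
  assumes "finite L"
  shows "int (coNPcc L F) = \<lceil>log 2 (bool_rank L (\<lambda>x y. \<not> F x y))\<rceil>"
proof -
  define r where "r = bool_rank L (\<lambda>x y. \<not> F x y)"
  have eq: "coNPcc L F = (LEAST k. r \<le> 2 ^ k)"
    unfolding coNPcc_def NPcc_def r_def using protocol_iff_bool_rank[OF assms] by simp
  show ?thesis
  proof (cases "r = 0")
    case True
    then show ?thesis
      using eq by (simp add: log_def flip: r_def)
  next
    case False
    have pow: "r \<le> 2 ^ k \<longleftrightarrow> log 2 r \<le> k" for k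
    proof -
      have "r \<le> 2 ^ k \<longleftrightarrow> real r \<le> 2 powr k"
        by (simp add: powr_realpow flip: of_nat_le_iff)
      also have "\<dots> \<longleftrightarrow> log 2 r \<le> k"
        using False by (simp add: log_le_iff)
      finally show ?thesis .
    qed
    have "0 \<le> log 2 r"
      using False by simp
    then have "(LEAST k. r \<le> 2 ^ k) = nat \<lceil>log 2 r\<rceil>"
      unfolding pow by (intro Least_equality) (linarith | simp add: nat_le_iff ceiling_le_iff)+
    then show ?thesis
      using eq \<open>0 \<le> log 2 r\<close> by (simp flip: r_def)
  qed
qed


section \<open>Certificate complexity\<close>

datatype literal = Pos nat | Neg nat

primrec var :: "literal \<Rightarrow> nat" where
  "var (Pos i) = i"
| "var (Neg i) = i"

primrec sat_literal :: "bool list \<Rightarrow> literal \<Rightarrow> bool" where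
  "sat_literal x (Pos i) \<longleftrightarrow> x ! i"
| "sat_literal x (Neg i) \<longleftrightarrow> \<not> x ! i"

text \<open>
  A DNF formula is the list of its clauses. The empty disjunction is false and the empty
  conjunction is true, so both constant functions are given by 0-DNF formulas.
\<close>

definition is_dnf :: "nat \<Rightarrow> nat \<Rightarrow> literal list list \<Rightarrow> bool" where
  "is_dnf n k cs \<longleftrightarrow> (\<forall>c\<in>set cs. length c \<le> k \<and> (\<forall>a\<in>set c. var a < n))"

definition sat_dnf :: "bool list \<Rightarrow> literal list list \<Rightarrow> bool" where
  "sat_dnf x cs \<longleftrightarrow> (\<exists>c\<in>set cs. \<forall>a\<in>set c. sat_literal x a)"

definition C1 :: "nat \<Rightarrow> (bool list \<Rightarrow> bool) \<Rightarrow> nat" where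
  "C1 n f = (LEAST k. \<exists>cs. is_dnf n k cs \<and> (\<forall>x\<in>bits n. f x \<longleftrightarrow> sat_dnf x cs))"

definition C0 :: "nat \<Rightarrow> (bool list \<Rightarrow> bool) \<Rightarrow> nat" where
  "C0 n f = C1 n (\<lambda>x. \<not> f x)"

end

theory Submission
  imports Defs
begin

text \<open>
  Let \<open>k\<close> be the co-nondeterministic complexity of \<open>f \<circ> g\<^sup>n\<close>, so that the zeros of this function are
  covered by at most \<open>2 ^ k\<close> rectangles of zeros. For a zero \<open>z\<close> of \<open>f\<close>, one of these rectangles, say \<open>R\<close>,
  contains at least a \<open>2 ^ - k\<close> fraction of all inputs that the gadgets map to \<open>z\<close>. It suffices to find a set \<open>I\<close> of
  \<open>O(k / (\<eta> l))\<close> coordinates such that every string that agrees with \<open>z\<close> on \<open>I\<close> is the gadget output of some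
  input in \<open>R\<close>: then \<open>f\<close> vanishes on that subcube, and these subcubes form a DNF formula for the negation of \<open>f\<close>.

  To find \<open>I\<close>, fix \<open>t = 2 powr \<rho>\<close> with \<open>\<rho> = \<eta> l / 32\<close>, put \<open>N = 2 ^ l\<close>, and consider all sub-rectangles \<open>A \<times> B\<close> of \<open>R\<close> in which the
  blocks of \<open>x\<close> and \<open>y\<close> at a set \<open>I\<close> of positions are fixed, with gadget values given by \<open>z\<close>. Choose
  the one that maximises
  \<open>h / ((2 t / N) ^ card I * sqrt (card A * card B))\<close>, where \<open>h\<close> is the number of
  inputs in \<open>A \<times> B\<close> with output \<open>z\<close>. Two facts about characters of the gadget outputs drive the proof, and
  both follow from one Cauchy-Schwarz estimate (\<open>corr_bound\<close>), whose error term is a fourfold sum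
  over the gadget matrix that multiplies over coordinates and is at most \<open>4 * disc * N ^ 4\<close>.

  First, no rectangle with the coordinates \<open>I\<close> fixed has \<open>h\<close> much above
  \<open>sqrt (card A * card B) * (N / 2) ^ (n - card I)\<close>. Comparing the maximal score with that of \<open>R\<close> gives
  \<open>t ^ card I \<le> 2 ^ (k + 1)\<close>, which is the desired bound on \<open>I\<close>.

  Second, at the maximum the rectangle is essentially spread out on the free coordinates. Fixing more
  blocks does not raise the score, which implies that rows whose blocks have an unusually popular value
  carry few of the inputs counted by \<open>h\<close> (\<open>heavy_hits_le\<close>). Deleting them does not raise the score
  either, and because the score is divided by the root of \<open>card A\<close>, at least half of the rows must
  survive (\<open>dense_part_exists\<close>). The same holds for the columns. On the remaining rectangle every
  nontrivial character on the free coordinates is small, so the gadget outputs there are nearly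
  uniform and in particular take every value (\<open>small_certificate\<close>).
\<close>

section \<open>The fourfold sum of a gadget and its discrepancy\<close>

definition sgn_mat :: "('a \<Rightarrow> 'a \<Rightarrow> bool) \<Rightarrow> 'a \<Rightarrow> 'a \<Rightarrow> real" where
  "sgn_mat g x y = (if g x y then 1 else -1)"

text \<open>
  This is the fourth power of the Gowers box norm of \<open>M\<close>, up to normalisation, and the fourth power of
  the Schatten 4-norm. It bounds the operator norm from above, it multiplies under tensor products,
  and for sign matrices it is controlled by the discrepancy.
\<close>

definition box_sum :: "'a set \<Rightarrow> ('a \<Rightarrow> 'a \<Rightarrow> real) \<Rightarrow> real" where
  "box_sum X M = (\<Sum>y\<in>X. \<Sum>y'\<in>X. (\<Sum>x\<in>X. M x y * M x y')\<^sup>2)"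

text \<open>
  The Cauchy-Schwarz inequality is applied twice: once to remove \<open>a\<close>, which duplicates \<open>y\<close>, and once
  to remove the products of two values of \<open>b\<close>. Keeping the Euclidean norms of \<open>a\<close> and \<open>b\<close>, instead of bounding
  these functions by 1, is what makes the estimate useful for small rectangles.
\<close>

lemma bilinear_le_box:
  fixes a b :: "'a \<Rightarrow> real"
  shows "(\<Sum>x\<in>X. \<Sum>y\<in>X. a x * b y * M x y) ^ 4
    \<le> (\<Sum>x\<in>X. (a x)\<^sup>2)\<^sup>2 * (\<Sum>y\<in>X. (b y)\<^sup>2)\<^sup>2 * box_sum X M"
proof -
  define r where "r x = (\<Sum>y\<in>X. b y * M x y)" for x
  define s where "s p = (\<Sum>x\<in>X. M x (fst p) * M x (snd p))" for p
  have "(\<Sum>x\<in>X. \<Sum>y\<in>X. a x * b y * M x y) = (\<Sum>x\<in>X. a x * r x)"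
    by (simp add: r_def sum_distrib_left mult.assoc)
  then have 1: "(\<Sum>x\<in>X. \<Sum>y\<in>X. a x * b y * M x y)\<^sup>2 \<le> (\<Sum>x\<in>X. (a x)\<^sup>2) * (\<Sum>x\<in>X. (r x)\<^sup>2)"
    using Cauchy_Schwarz_ineq_sum[of a r X] by simp
  have "(\<Sum>x\<in>X. (r x)\<^sup>2) = (\<Sum>x\<in>X. \<Sum>y\<in>X. \<Sum>y'\<in>X. b y * b y' * (M x y * M x y'))"
    unfolding r_def power2_eq_square sum_product by (simp add: mult_ac)
  also have "\<dots> = (\<Sum>y\<in>X. \<Sum>y'\<in>X. \<Sum>x\<in>X. b y * b y' * (M x y * M x y'))"
    by (subst sum.swap, rule sum.cong[OF refl], rule sum.swap)
  also have "\<dots> = (\<Sum>y\<in>X. \<Sum>y'\<in>X. (b y * b y') * s (y, y'))"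
    by (simp add: s_def sum_distrib_left)
  also have "\<dots> = (\<Sum>p\<in>X\<times>X. (b (fst p) * b (snd p)) * s p)"
    by (simp add: sum.cartesian_product case_prod_unfold)
  finally have "(\<Sum>x\<in>X. (r x)\<^sup>2)\<^sup>2
      \<le> (\<Sum>p\<in>X\<times>X. (b (fst p) * b (snd p))\<^sup>2) * (\<Sum>p\<in>X\<times>X. (s p)\<^sup>2)"
    using Cauchy_Schwarz_ineq_sum[of "\<lambda>p. b (fst p) * b (snd p)" s "X \<times> X"] by simp
  moreover have "(\<Sum>p\<in>X\<times>X. (b (fst p) * b (snd p))\<^sup>2) = (\<Sum>y\<in>X. (b y)\<^sup>2)\<^sup>2"
    by (simp add: power2_eq_square[of "\<Sum>y\<in>X. (b y)\<^sup>2"] sum_product sum.cartesian_product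
        case_prod_unfold power_mult_distrib)
  moreover have "(\<Sum>p\<in>X\<times>X. (s p)\<^sup>2) = box_sum X M"
    by (simp add: box_sum_def s_def sum.cartesian_product case_prod_unfold)
  ultimately have 2: "(\<Sum>x\<in>X. (r x)\<^sup>2)\<^sup>2 \<le> (\<Sum>y\<in>X. (b y)\<^sup>2)\<^sup>2 * box_sum X M"
    by simp
  have "(\<Sum>x\<in>X. \<Sum>y\<in>X. a x * b y * M x y) ^ 4
      = ((\<Sum>x\<in>X. \<Sum>y\<in>X. a x * b y * M x y)\<^sup>2)\<^sup>2"
    by simp
  also have "\<dots> \<le> ((\<Sum>x\<in>X. (a x)\<^sup>2) * (\<Sum>x\<in>X. (r x)\<^sup>2))\<^sup>2"
    by (rule power_mono[OF 1]) simp
  also have "\<dots> \<le> (\<Sum>x\<in>X. (a x)\<^sup>2)\<^sup>2 * ((\<Sum>y\<in>X. (b y)\<^sup>2)\<^sup>2 * box_sum X M)"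
    unfolding power_mult_distrib by (rule mult_left_mono[OF 2]) simp
  finally show ?thesis by (simp add: mult.assoc)
qed

text \<open>
  Each of the four sums over \<open>PiE S (\<lambda>_. L)\<close> distributes over the product of the coordinates. This
  replaces an XOR lemma for discrepancy.
\<close>

lemma box_tensor:
  assumes "finite S" "finite L"
  shows "box_sum (PiE S (\<lambda>_. L)) (\<lambda>x y. \<Prod>i\<in>S. M (x i) (y i)) = box_sum L M ^ card S"
proof -
  let ?P = "PiE S (\<lambda>_. L)"
  have 1: "(\<Sum>x\<in>?P. \<Prod>i\<in>S. h i (x i)) = (\<Prod>i\<in>S. \<Sum>x\<in>L. h i x)" for h :: "_ \<Rightarrow> _ \<Rightarrow> real"
    using assms by (intro prod_sum_PiE[symmetric]) auto
  have "(\<Sum>x\<in>?P. (\<Prod>i\<in>S. M (x i) (y i)) * (\<Prod>i\<in>S. M (x i) (y' i)))\<^sup>2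
      = (\<Prod>i\<in>S. (\<Sum>x\<in>L. M x (y i) * M x (y' i))\<^sup>2)" for y y'
    using 1[of "\<lambda>i x. M x (y i) * M x (y' i)"] by (simp only: prod.distrib prod_power_distrib)
  then have "box_sum ?P (\<lambda>x y. \<Prod>i\<in>S. M (x i) (y i))
      = (\<Sum>y\<in>?P. \<Sum>y'\<in>?P. \<Prod>i\<in>S. (\<Sum>x\<in>L. M x (y i) * M x (y' i))\<^sup>2)"
    by (simp only: box_sum_def)
  also have "\<dots> = (\<Sum>y\<in>?P. \<Prod>i\<in>S. \<Sum>y'\<in>L. (\<Sum>x\<in>L. M x (y i) * M x y')\<^sup>2)"
    by (intro sum.cong refl 1)
  also have "\<dots> = (\<Prod>i\<in>S. \<Sum>y\<in>L. \<Sum>y'\<in>L. (\<Sum>x\<in>L. M x y * M x y')\<^sup>2)"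
    by (rule 1)
  finally show ?thesis by (simp add: box_sum_def)
qed

lemma pair_pmf_of_set:
  assumes "finite A" "A \<noteq> {}" "finite B" "B \<noteq> {}"
  shows "pair_pmf (pmf_of_set A) (pmf_of_set B) = pmf_of_set (A \<times> B)"
proof (rule pmf_eqI)
  fix p :: "'a \<times> 'b"
  obtain a b where "p = (a, b)" by (cases p)
  moreover have "A \<times> B \<noteq> {}" "finite (A \<times> B)" using assms by auto
  ultimately show "pmf (pair_pmf (pmf_of_set A) (pmf_of_set B)) p = pmf (pmf_of_set (A \<times> B)) p"
    using assms by (simp add: pmf_pair pmf_of_set card_cartesian_product indicator_def)
qed

lemma disc_rect_eq:
  assumes "finite L" "L \<noteq> {}" "A \<subseteq> L" "B \<subseteq> L"
  shows "disc_rect L g A B = \<bar>\<Sum>x\<in>A. \<Sum>y\<in>B. sgn_mat g x y\<bar> / (real (card L))\<^sup>2"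
proof -
  have fin: "finite (A \<times> B)"
    using assms finite_subset by blast
  have p: "measure_pmf.prob (pmf_of_set (L \<times> L)) {(x, y). P x y \<and> (x, y) \<in> A \<times> B}
      = card {p\<in>A\<times>B. P (fst p) (snd p)} / (real (card L))\<^sup>2" for P
  proof -
    have "(L \<times> L) \<inter> {(x, y). P x y \<and> (x, y) \<in> A \<times> B} = {p\<in>A\<times>B. P (fst p) (snd p)}"
      using assms(3,4) by auto
    moreover have "L \<times> L \<noteq> {}" "finite (L \<times> L)"
      using assms by auto
    ultimately show ?thesis
      by (subst measure_pmf_of_set) (simp_all add: card_cartesian_product power2_eq_square)
  qed
  have "(\<Sum>x\<in>A. \<Sum>y\<in>B. sgn_mat g x y) = (\<Sum>p\<in>A\<times>B. if g (fst p) (snd p) then 1 else - 1)"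
    by (simp add: sum.cartesian_product sgn_mat_def case_prod_unfold)
  also have "\<dots> = real (card {p\<in>A\<times>B. g (fst p) (snd p)}) - card {p\<in>A\<times>B. \<not> g (fst p) (snd p)}"
    unfolding sum.If_cases[OF fin] by (simp add: Int_def)
  finally have "\<bar>\<Sum>x\<in>A. \<Sum>y\<in>B. sgn_mat g x y\<bar>
      = \<bar>real (card {p\<in>A\<times>B. \<not> g (fst p) (snd p)}) - card {p\<in>A\<times>B. g (fst p) (snd p)}\<bar>"
    by linarith
  then show ?thesis
    unfolding disc_rect_def Let_def pair_pmf_of_set[OF assms(1,2) assms(1,2)]
      p[of "\<lambda>x y. g x y"] p[of "\<lambda>x y. \<not> g x y"]
    by (simp only: abs_divide abs_power2 abs_of_nat power_abs flip: diff_divide_distrib)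
qed

lemma rect_sum_le_disc:
  assumes "finite L" "L \<noteq> {}" "A \<subseteq> L" "B \<subseteq> L"
  shows "\<bar>\<Sum>x\<in>A. \<Sum>y\<in>B. sgn_mat g x y\<bar> \<le> disc L g * (real (card L))\<^sup>2"
proof -
  have "{disc_rect L g A B | A B. A \<subseteq> L \<and> B \<subseteq> L}
      = (\<lambda>(A, B). disc_rect L g A B) ` (Pow L \<times> Pow L)"
    by auto
  then have "finite {disc_rect L g A B | A B. A \<subseteq> L \<and> B \<subseteq> L}"
    using assms(1) by simp
  then have "disc_rect L g A B \<le> disc L g"
    unfolding disc_def by (rule Max_ge) (use assms in blast)
  moreover have "(real (card L))\<^sup>2 > 0"
    using assms by (simp add: card_gt_0_iff)
  ultimately show ?thesis
    by (simp add: disc_rect_eq[OF assms] pos_divide_le_eq)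
qed

lemma signed_sum_split:
  assumes "finite L" and a: "\<And>x. x \<in> L \<Longrightarrow> \<bar>a x\<bar> = (1::real)"
  shows "(\<Sum>x\<in>L. a x * h x) = (\<Sum>x | x \<in> L \<and> a x = 1. h x) - (\<Sum>x | x \<in> L \<and> a x \<noteq> 1. h x)"
proof -
  have "a x * h x = (if a x = 1 then h x else - h x)" if "x \<in> L" for x
  proof -
    have "a x = 1 \<or> a x = -1"
      using a[OF that] by linarith
    then show ?thesis by auto
  qed
  then have "(\<Sum>x\<in>L. a x * h x) = (\<Sum>x\<in>L. if a x = 1 then h x else - h x)"
    by (rule sum.cong[OF refl])
  also have "\<dots> = (\<Sum>x | x \<in> L \<and> a x = 1. h x) - (\<Sum>x | x \<in> L \<and> a x \<noteq> 1. h x)"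
    using assms(1) by (simp add: sum.If_cases sum_negf Int_def)
  finally show ?thesis .
qed

text \<open>
  Sign functions \<open>a\<close> and \<open>b\<close> cut \<open>L \<times> L\<close> into four rectangles, on each of which \<open>a x * b y\<close> is
  constant.
\<close>

lemma signed_sum_le_disc:
  assumes L: "finite L" "L \<noteq> {}"
    and a: "\<And>x. x \<in> L \<Longrightarrow> \<bar>a x\<bar> = 1" and b: "\<And>y. y \<in> L \<Longrightarrow> \<bar>b y\<bar> = (1::real)"
  shows "\<bar>\<Sum>x\<in>L. \<Sum>y\<in>L. a x * b y * sgn_mat g x y\<bar> \<le> 4 * disc L g * (real (card L))\<^sup>2"
proof -
  define Ap Am where "Ap = {x. x \<in> L \<and> a x = 1}" and "Am = {x. x \<in> L \<and> a x \<noteq> 1}"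
  define Bp Bm where "Bp = {y. y \<in> L \<and> b y = 1}" and "Bm = {y. y \<in> L \<and> b y \<noteq> 1}"
  have sub: "Ap \<subseteq> L" "Am \<subseteq> L" "Bp \<subseteq> L" "Bm \<subseteq> L"
    by (auto simp: Ap_def Am_def Bp_def Bm_def)
  note eA = signed_sum_split[OF L(1), of a, OF a, folded Ap_def Am_def]
  note eB = signed_sum_split[OF L(1), of b, OF b, folded Bp_def Bm_def]
  have "(\<Sum>x\<in>L. \<Sum>y\<in>L. a x * b y * sgn_mat g x y) = (\<Sum>x\<in>L. a x * (\<Sum>y\<in>L. b y * sgn_mat g x y))"
    by (simp add: sum_distrib_left mult.assoc)
  also have "\<dots> = (\<Sum>x\<in>Ap. \<Sum>y\<in>Bp. sgn_mat g x y) - (\<Sum>x\<in>Ap. \<Sum>y\<in>Bm. sgn_mat g x y)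
     - ((\<Sum>x\<in>Am. \<Sum>y\<in>Bp. sgn_mat g x y) - (\<Sum>x\<in>Am. \<Sum>y\<in>Bm. sgn_mat g x y))"
    by (simp add: eA eB sum_subtractf)
  finally show ?thesis
    using rect_sum_le_disc[OF L sub(1) sub(3), of g] rect_sum_le_disc[OF L sub(1) sub(4), of g]
      rect_sum_le_disc[OF L sub(2) sub(3), of g] rect_sum_le_disc[OF L sub(2) sub(4), of g]
    by linarith
qed

text \<open>
  Once \<open>x'\<close> and \<open>y'\<close> are fixed, the summand is \<open>sgn_mat g x y\<close> times a sign that depends only on \<open>x\<close>
  times a sign that depends only on \<open>y\<close>.
\<close>

lemma box_le_disc:
  assumes L: "finite L" "L \<noteq> {}"
  shows "box_sum L (sgn_mat g) \<le> 4 * disc L g * real (card L) ^ 4"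
proof -
  let ?G = "sgn_mat g"
  have G: "\<bar>?G x y\<bar> = 1" for x y by (simp add: sgn_mat_def)
  have "box_sum L ?G = (\<Sum>y\<in>L. \<Sum>y'\<in>L. \<Sum>x\<in>L. \<Sum>x'\<in>L. ?G x y * ?G x y' * (?G x' y * ?G x' y'))"
    by (simp add: box_sum_def power2_eq_square sum_product)
  also have "\<dots> = (\<Sum>y'\<in>L. \<Sum>y\<in>L. \<Sum>x\<in>L. \<Sum>x'\<in>L. ?G x y * ?G x y' * (?G x' y * ?G x' y'))"
    by (rule sum.swap)
  also have "\<dots> = (\<Sum>y'\<in>L. \<Sum>x\<in>L. \<Sum>y\<in>L. \<Sum>x'\<in>L. ?G x y * ?G x y' * (?G x' y * ?G x' y'))"
    by (rule sum.cong[OF refl], rule sum.swap)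
  also have "\<dots> = (\<Sum>y'\<in>L. \<Sum>x\<in>L. \<Sum>x'\<in>L. \<Sum>y\<in>L. ?G x y * ?G x y' * (?G x' y * ?G x' y'))"
    by (rule sum.cong[OF refl], rule sum.cong[OF refl], rule sum.swap)
  also have "\<dots> = (\<Sum>y'\<in>L. \<Sum>x'\<in>L. \<Sum>x\<in>L. \<Sum>y\<in>L. ?G x y * ?G x y' * (?G x' y * ?G x' y'))"
    by (rule sum.cong[OF refl], rule sum.swap)
  also have "\<dots> \<le> (\<Sum>y'\<in>L. \<Sum>x'\<in>L. 4 * disc L g * (real (card L))\<^sup>2)"
  proof (intro sum_mono)
    fix y' x'
    have "(\<Sum>x\<in>L. \<Sum>y\<in>L. ?G x y * ?G x y' * (?G x' y * ?G x' y'))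
        = (\<Sum>x\<in>L. \<Sum>y\<in>L. (?G x y' * ?G x' y') * ?G x' y * ?G x y)"
      by (simp add: mult_ac)
    also have "\<dots> \<le> 4 * disc L g * (real (card L))\<^sup>2"
      using signed_sum_le_disc[OF L, of "\<lambda>x. ?G x y' * ?G x' y'" "\<lambda>y. ?G x' y" g]
      by (simp add: abs_mult G)
    finally show "(\<Sum>x\<in>L. \<Sum>y\<in>L. ?G x y * ?G x y' * (?G x' y * ?G x' y')) \<le> 4 * disc L g * (real (card L))\<^sup>2" .
  qed
  also have "\<dots> = 4 * disc L g * real (card L) ^ 4"
    by (simp add: power2_eq_square power4_eq_xxxx)
  finally show ?thesis .
qed

section \<open>Counting inputs by characters\<close>

definition hits :: "('a \<Rightarrow> 'a \<Rightarrow> bool) \<Rightarrow> 'i set \<Rightarrow> ('i \<Rightarrow> bool)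
    \<Rightarrow> ('i \<Rightarrow> 'a) set \<Rightarrow> ('i \<Rightarrow> 'a) set \<Rightarrow> nat" where
  "hits g V z A B = card {p \<in> A \<times> B. \<forall>i\<in>V. g (fst p i) (snd p i) = z i}"

text \<open>
  The Fourier coefficient at the character \<open>S\<close> of the distribution of the gadget outputs on
  \<open>A \<times> B\<close>, not normalised.
\<close>

definition corr :: "('a \<Rightarrow> 'a \<Rightarrow> bool) \<Rightarrow> 'i set \<Rightarrow> ('i \<Rightarrow> 'a) set \<Rightarrow> ('i \<Rightarrow> 'a) set \<Rightarrow> real" where
  "corr g S A B = (\<Sum>x\<in>A. \<Sum>y\<in>B. \<Prod>i\<in>S. sgn_mat g (x i) (y i))"

definition fibre :: "'i set \<Rightarrow> ('i \<Rightarrow> 'a) set \<Rightarrow> ('i \<Rightarrow> 'a) \<Rightarrow> ('i \<Rightarrow> 'a) set" where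
  "fibre S A \<alpha> = {x \<in> A. restrict x S = \<alpha>}"

text \<open>
  Restricting a rectangle to a subcube is expressed by this predicate, so that all inputs stay
  functions on the same coordinate set and no change of index set is ever needed.
\<close>

definition fixes_coords :: "'i set \<Rightarrow> ('i \<Rightarrow> 'a) set \<Rightarrow> bool" where
  "fixes_coords I A \<longleftrightarrow> (\<forall>x\<in>A. \<forall>x'\<in>A. \<forall>i\<in>I. x i = x' i)"

lemma sum_power_card_Pow:
  fixes c :: "'b::comm_semiring_1"
  assumes "finite V"
  shows "(\<Sum>S\<in>Pow V. c ^ card S) = (1 + c) ^ card V"
  using prod_add[OF assms, of "\<lambda>_. c" "\<lambda>_. 1"] by (simp add: add.commute)

text \<open>
  The indicator of \<open>g (x i) (y i) = z i\<close> is \<open>(1 \<plusminus> sgn_mat g (x i) (y i)) / 2\<close>; the product over \<open>V\<close> is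
  expanded into characters.
\<close>

lemma hits_expansion:
  assumes V: "finite V" and AB: "finite A" "finite B"
  shows "2 ^ card V * real (hits g V z A B)
    = (\<Sum>S\<in>Pow V. (\<Prod>i\<in>S. if z i then 1 else -1) * corr g S A B)"
proof -
  let ?s = "\<lambda>i. if z i then 1 else (-1::real)"
  have fin: "finite (A \<times> B)"
    using AB by simp
  have "2 ^ card V * (if \<forall>i\<in>V. g (x i) (y i) = z i then 1 else 0)
      = (\<Sum>S\<in>Pow V. (\<Prod>i\<in>S. ?s i) * (\<Prod>i\<in>S. sgn_mat g (x i) (y i)))" for x y
  proof -
    have "(\<Prod>i\<in>V. ?s i * sgn_mat g (x i) (y i) + 1)
        = (\<Prod>i\<in>V. if g (x i) (y i) = z i then 2 else (0::real))"
      by (rule prod.cong) (auto simp: sgn_mat_def)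
    also have "\<dots> = 2 ^ card V * (if \<forall>i\<in>V. g (x i) (y i) = z i then 1 else 0)"
    proof (cases "\<forall>i\<in>V. g (x i) (y i) = z i")
      case True
      then have "(\<Prod>i\<in>V. if g (x i) (y i) = z i then 2 else (0::real)) = (\<Prod>i\<in>V. 2)"
        by (intro prod.cong) auto
      then show ?thesis using True by simp
    next
      case False
      then show ?thesis using V by (auto intro!: prod_zero)
    qed
    finally show ?thesis
      unfolding prod_add[OF V] by (simp add: prod.distrib)
  qed
  then have "(\<Sum>x\<in>A. \<Sum>y\<in>B. 2 ^ card V * (if \<forall>i\<in>V. g (x i) (y i) = z i then 1 else 0))
      = (\<Sum>x\<in>A. \<Sum>y\<in>B. \<Sum>S\<in>Pow V. (\<Prod>i\<in>S. ?s i) * (\<Prod>i\<in>S. sgn_mat g (x i) (y i)))"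
    by simp
  also have "\<dots> = (\<Sum>x\<in>A. \<Sum>S\<in>Pow V. \<Sum>y\<in>B. (\<Prod>i\<in>S. ?s i) * (\<Prod>i\<in>S. sgn_mat g (x i) (y i)))"
    by (rule sum.cong[OF refl], rule sum.swap)
  also have "\<dots> = (\<Sum>S\<in>Pow V. \<Sum>x\<in>A. \<Sum>y\<in>B. (\<Prod>i\<in>S. ?s i) * (\<Prod>i\<in>S. sgn_mat g (x i) (y i)))"
    by (rule sum.swap)
  also have "\<dots> = (\<Sum>S\<in>Pow V. (\<Prod>i\<in>S. ?s i) * corr g S A B)"
    by (simp only: corr_def sum_distrib_left)
  finally have "(\<Sum>x\<in>A. \<Sum>y\<in>B. 2 ^ card V * (if \<forall>i\<in>V. g (x i) (y i) = z i then 1 else 0))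
      = (\<Sum>S\<in>Pow V. (\<Prod>i\<in>S. ?s i) * corr g S A B)" .
  moreover have "(\<Sum>x\<in>A. \<Sum>y\<in>B. 2 ^ card V * (if \<forall>i\<in>V. g (x i) (y i) = z i then 1 else (0::real)))
      = 2 ^ card V * (\<Sum>p\<in>A\<times>B. if \<forall>i\<in>V. g (fst p i) (snd p i) = z i then 1 else 0)"
    by (simp only: sum.cartesian_product case_prod_unfold sum_distrib_left)
  moreover have "(\<Sum>p\<in>A\<times>B. if \<forall>i\<in>V. g (fst p i) (snd p i) = z i then 1 else (0::real))
      = real (hits g V z A B)"
    unfolding hits_def sum.If_cases[OF fin] by (simp add: Int_def)
  ultimately show ?thesis by simp
qed

lemma abs_prod_signs: "\<bar>\<Prod>i\<in>S. if z i then 1 else (-1::real)\<bar> = 1"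
  by (simp add: abs_prod if_distrib cong: if_cong)

lemma hits_le_corr:
  assumes "finite V" "finite A" "finite B"
  shows "2 ^ card V * real (hits g V z A B) \<le> (\<Sum>S\<in>Pow V. \<bar>corr g S A B\<bar>)"
proof -
  have "\<bar>2 ^ card V * real (hits g V z A B)\<bar> \<le> (\<Sum>S\<in>Pow V. \<bar>corr g S A B\<bar>)"
    unfolding hits_expansion[OF assms] by (rule order_trans[OF sum_abs]) (simp add: abs_mult abs_prod_signs)
  then show ?thesis by linarith
qed

text \<open>
  The empty character contributes the expected main term \<open>card A * card B\<close>.
\<close>

lemma hits_ge_corr:
  assumes "finite V" "finite A" "finite B"
  shows "2 ^ card V * real (hits g V z A B)
    \<ge> real (card A) * real (card B) - (\<Sum>S\<in>Pow V - {{}}. \<bar>corr g S A B\<bar>)"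
proof -
  let ?s = "\<lambda>i. if z i then 1 else (-1::real)"
  have "2 ^ card V * real (hits g V z A B) = real (card A) * real (card B)
      + (\<Sum>S\<in>Pow V - {{}}. (\<Prod>i\<in>S. ?s i) * corr g S A B)"
    using assms(1) by (simp add: hits_expansion[OF assms] sum.remove[of _ "{}"] corr_def)
  moreover have "\<bar>\<Sum>S\<in>Pow V - {{}}. (\<Prod>i\<in>S. ?s i) * corr g S A B\<bar>
      \<le> (\<Sum>S\<in>Pow V - {{}}. \<bar>corr g S A B\<bar>)"
    by (rule order_trans[OF sum_abs]) (simp add: abs_mult abs_prod_signs)
  ultimately show ?thesis by linarith
qed

lemma sum_over_fibres:
  fixes h :: "_ \<Rightarrow> real"
  assumes "finite T" "finite L" "A \<subseteq> PiE T (\<lambda>_. L)" "S \<subseteq> T"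
  shows "(\<Sum>x\<in>A. h (restrict x S)) = (\<Sum>\<alpha>\<in>PiE S (\<lambda>_. L). real (card (fibre S A \<alpha>)) * h \<alpha>)"
proof -
  have fA: "finite A" and fS: "finite (PiE S (\<lambda>_. L))"
    using assms by (auto intro!: finite_PiE elim!: finite_subset)
  have im: "(\<lambda>x. restrict x S) ` A \<subseteq> PiE S (\<lambda>_. L)"
    using assms(3,4) by fastforce
  have "(\<Sum>x\<in>A. h (restrict x S))
      = (\<Sum>\<alpha>\<in>PiE S (\<lambda>_. L). \<Sum>x | x \<in> A \<and> restrict x S = \<alpha>. h (restrict x S))"
    by (rule sum.group[OF fA fS im, symmetric])
  also have "\<dots> = (\<Sum>\<alpha>\<in>PiE S (\<lambda>_. L). \<Sum>x\<in>fibre S A \<alpha>. h \<alpha>)"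
    by (intro sum.cong refl) (auto simp: fibre_def)
  finally show ?thesis by simp
qed

lemma sum_card_fibre_square:
  assumes "finite T" "finite L" "A \<subseteq> PiE T (\<lambda>_. L)" "S \<subseteq> T"
    and P: "\<And>\<alpha>. real (card (fibre S A \<alpha>)) \<le> P"
  shows "(\<Sum>\<alpha>\<in>PiE S (\<lambda>_. L). (real (card (fibre S A \<alpha>)))\<^sup>2) \<le> P * real (card A)"
proof -
  have "(\<Sum>\<alpha>\<in>PiE S (\<lambda>_. L). (real (card (fibre S A \<alpha>)))\<^sup>2)
      = (\<Sum>x\<in>A. real (card (fibre S A (restrict x S))))"
    using sum_over_fibres[OF assms(1-4), of "\<lambda>\<alpha>. real (card (fibre S A \<alpha>))"]
    by (simp add: power2_eq_square)
  also have "\<dots> \<le> (\<Sum>x\<in>A. P)"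
    by (rule sum_mono) (rule P)
  finally show ?thesis by (simp add: mult.commute)
qed

text \<open>
  A character depends only on the coordinates in \<open>S\<close>, so \<open>A\<close> and \<open>B\<close> enter only through their fibre
  sizes, whose Euclidean norm is small when no fibre is large. The two instances used later bound the fibres
  by the dimension of the subcube (for arbitrary rectangles), and by the spread property
  (for rectangles without heavy fibres).
\<close>

lemma corr_bound:
  assumes T: "finite T" "finite L" and AB: "A \<subseteq> PiE T (\<lambda>_. L)" "B \<subseteq> PiE T (\<lambda>_. L)" and S: "S \<subseteq> T"
    and P: "\<And>\<alpha>. real (card (fibre S A \<alpha>)) \<le> P" and Q: "\<And>\<beta>. real (card (fibre S B \<beta>)) \<le> Q"
    and box: "box_sum L (sgn_mat g) \<le> \<tau> ^ 4" and \<tau>: "\<tau> \<ge> 0"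
  shows "\<bar>corr g S A B\<bar> \<le> sqrt (P * real (card A)) * sqrt (Q * real (card B)) * \<tau> ^ card S"
proof -
  let ?X = "PiE S (\<lambda>_. L)" and ?M = "\<lambda>x y. \<Prod>i\<in>S. sgn_mat g (x i) (y i)"
  let ?a = "\<lambda>\<alpha>. real (card (fibre S A \<alpha>))" and ?b = "\<lambda>\<beta>. real (card (fibre S B \<beta>))"
  have fS: "finite S" using T S finite_subset by blast
  have "0 \<le> P" "0 \<le> Q"
    using P Q by (meson of_nat_0_le_iff order_trans)+
  have "corr g S A B = (\<Sum>x\<in>A. \<Sum>y\<in>B. ?M (restrict x S) (restrict y S))"
    by (simp add: corr_def)
  also have "\<dots> = (\<Sum>\<alpha>\<in>?X. ?a \<alpha> * (\<Sum>y\<in>B. ?M \<alpha> (restrict y S)))"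
    by (rule sum_over_fibres[OF T AB(1) S])
  also have "\<dots> = (\<Sum>\<alpha>\<in>?X. ?a \<alpha> * (\<Sum>\<beta>\<in>?X. ?b \<beta> * ?M \<alpha> \<beta>))"
    by (intro sum.cong refl arg_cong2[of _ _ _ _ "(*)"] sum_over_fibres[OF T AB(2) S])
  also have "\<dots> = (\<Sum>\<alpha>\<in>?X. \<Sum>\<beta>\<in>?X. ?a \<alpha> * ?b \<beta> * ?M \<alpha> \<beta>)"
    by (simp only: sum_distrib_left mult.assoc)
  finally have "corr g S A B ^ 4
      \<le> (\<Sum>\<alpha>\<in>?X. (?a \<alpha>)\<^sup>2)\<^sup>2 * (\<Sum>\<beta>\<in>?X. (?b \<beta>)\<^sup>2)\<^sup>2 * box_sum ?X ?M"
    using bilinear_le_box[of ?a ?b ?M ?X] by simp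
  also have "\<dots> \<le> (P * card A)\<^sup>2 * (Q * card B)\<^sup>2 * (\<tau> ^ 4) ^ card S"
    unfolding box_tensor[OF fS T(2)]
  proof (intro mult_mono power_mono)
    show "(\<Sum>\<alpha>\<in>?X. (?a \<alpha>)\<^sup>2) \<le> P * card A" by (rule sum_card_fibre_square[OF T AB(1) S P])
    show "(\<Sum>\<beta>\<in>?X. (?b \<beta>)\<^sup>2) \<le> Q * card B" by (rule sum_card_fibre_square[OF T AB(2) S Q])
  qed (use box in \<open>auto simp: box_sum_def sum_nonneg\<close>)
  also have "\<dots> = (sqrt (P * card A) * sqrt (Q * card B) * \<tau> ^ card S) ^ 4"
  proof -
    have sq: "sqrt x ^ 4 = x\<^sup>2" if "x \<ge> 0" for x
      using that by (metis mult_2_right numeral_Bit0 power_mult real_sqrt_pow2 power_add power2_eq_square)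
    show ?thesis
      using \<open>0 \<le> P\<close> \<open>0 \<le> Q\<close> by (simp add: power_mult_distrib sq flip: power_mult) (simp add: mult.commute)
  qed
  finally have "\<bar>corr g S A B\<bar> ^ 4 \<le> (sqrt (P * card A) * sqrt (Q * card B) * \<tau> ^ card S) ^ 4"
    by simp
  then show ?thesis
    by (rule power_le_imp_le_base[of _ 3, simplified]) (use \<open>0 \<le> P\<close> \<open>0 \<le> Q\<close> \<tau> in simp)
qed

text \<open>
  A point of a fibre over \<open>S\<close> is determined by its free coordinates outside \<open>S\<close>, because those in \<open>I\<close>
  are fixed.
\<close>

lemma corr_bound_const:
  fixes \<delta> :: real
  assumes T: "finite T" "finite L" and AB: "A \<subseteq> PiE T (\<lambda>_. L)" "B \<subseteq> PiE T (\<lambda>_. L)"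
    and I: "I \<subseteq> T" and S: "S \<subseteq> T - I"
    and cA: "fixes_coords I A" and cB: "fixes_coords I B"
    and box: "box_sum L (sgn_mat g) \<le> (\<delta> * card L) ^ 4" and \<delta>: "\<delta> \<ge> 0"
  shows "\<bar>corr g S A B\<bar> \<le> sqrt (real (card A) * real (card B)) * real (card L) ^ card (T - I) * \<delta> ^ card S"
proof -
  let ?N = "real (card L)" and ?m = "card (T - I) - card S"
  have fib: "real (card (fibre S D \<alpha>)) \<le> ?N ^ ?m" if D: "D \<subseteq> PiE T (\<lambda>_. L)" "fixes_coords I D" for D \<alpha>
  proof -
    let ?U = "T - I - S"
    have "inj_on (\<lambda>x. restrict x ?U) (fibre S D \<alpha>)"
    proof (rule inj_onI)
      fix x x' assume x: "x \<in> fibre S D \<alpha>" "x' \<in> fibre S D \<alpha>" "restrict x ?U = restrict x' ?U"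
      have xD: "x \<in> D" "x' \<in> D" "restrict x S = restrict x' S" using x by (auto simp: fibre_def)
      show "x = x'"
      proof
        fix i
        consider "i \<notin> T" | "i \<in> I" | "i \<in> S" | "i \<in> ?U" using S by blast
        then show "x i = x' i"
        proof cases
          case 1 then show ?thesis using D(1) xD by (metis PiE_arb subsetD)
        next
          case 2 then show ?thesis using D(2) xD by (auto simp: fixes_coords_def)
        next
          case 3 then show ?thesis using xD(3) by (metis restrict_apply')
        next
          case 4 then show ?thesis using x(3) by (metis restrict_apply')
        qed
      qed
    qed
    moreover have "(\<lambda>x. restrict x ?U) ` fibre S D \<alpha> \<subseteq> PiE ?U (\<lambda>_. L)"
      using D(1) by (fastforce simp: fibre_def)
    moreover have "finite (PiE ?U (\<lambda>_. L))" using T by (intro finite_PiE) auto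
    ultimately have "card (fibre S D \<alpha>) \<le> card (PiE ?U (\<lambda>_. L))"
      by (meson card_inj_on_le)
    also have "\<dots> = card L ^ card ?U" using T by (simp add: card_PiE)
    also have "card ?U = ?m" using T S finite_subset by (subst card_Diff_subset) auto
    finally show ?thesis by (simp flip: of_nat_power)
  qed
  have "\<bar>corr g S A B\<bar> \<le> sqrt (?N ^ ?m * card A) * sqrt (?N ^ ?m * card B) * (\<delta> * ?N) ^ card S"
    using I S by (intro corr_bound[OF T AB _ fib[OF AB(1) cA] fib[OF AB(2) cB] box]) (auto simp: \<delta>)
  also have "\<dots> = sqrt (real (card A) * real (card B)) * (?N ^ ?m * ?N ^ card S) * \<delta> ^ card S"
    by (simp add: real_sqrt_mult power_mult_distrib mult_ac)
  also have "?N ^ ?m * ?N ^ card S = ?N ^ card (T - I)"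
    using S T card_mono[of "T - I" S] by (simp flip: power_add)
  finally show ?thesis .
qed

section \<open>Removing heavy inputs from a rectangle\<close>

text \<open>
  With \<open>c = \<beta> / card L\<close>, a fibre over \<open>S\<close> exceeds its average size by a factor of at most
  \<open>2 * \<beta> ^ card S\<close>: every block of coordinates of a uniform element of \<open>A\<close> has min-entropy close to
  the maximum.
\<close>

definition spread :: "real \<Rightarrow> 'i set \<Rightarrow> ('i \<Rightarrow> 'a) set \<Rightarrow> bool" where
  "spread c V A \<longleftrightarrow> (\<forall>S\<subseteq>V. \<forall>\<alpha>. real (card (fibre S A \<alpha>)) \<le> 2 * c ^ card S * real (card A))"

lemma hits_Un_le:
  "hits g V z (A \<union> A') B \<le> hits g V z A B + hits g V z A' B"
proof -
  have "{p \<in> (A \<union> A') \<times> B. \<forall>i\<in>V. g (fst p i) (snd p i) = z i}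
      = {p \<in> A \<times> B. \<forall>i\<in>V. g (fst p i) (snd p i) = z i}
      \<union> {p \<in> A' \<times> B. \<forall>i\<in>V. g (fst p i) (snd p i) = z i}"
    by auto
  then show ?thesis
    unfolding hits_def by (simp only: card_Un_le)
qed

lemma hits_UN_le:
  assumes "finite \<J>"
  shows "hits g V z (\<Union>J\<in>\<J>. H J) B \<le> (\<Sum>J\<in>\<J>. hits g V z (H J) B)"
  using assms
proof induction
  case empty
  then show ?case by (simp add: hits_def)
next
  case (insert J \<J>)
  then show ?case
    using hits_Un_le[of g V z "H J" "\<Union>J\<in>\<J>. H J" B] by simp
qed

text \<open>
  This exchanges the two players, so that what is proved for the rows of a rectangle also holds for
  its columns.
\<close>

lemma hits_swap: "hits (\<lambda>x y. g y x) V z B A = hits g V z A B"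
proof -
  have "bij_betw prod.swap {p \<in> B \<times> A. \<forall>i\<in>V. g (snd p i) (fst p i) = z i}
    {p \<in> A \<times> B. \<forall>i\<in>V. g (fst p i) (snd p i) = z i}"
    by (rule bij_betwI[of _ _ _ prod.swap]) (simp_all add: Pi_def mem_Times_iff)
  then show ?thesis
    by (simp add: hits_def bij_betw_same_card)
qed

lemma sum_card_fibre:
  assumes "finite T" "finite L" "A \<subseteq> PiE T (\<lambda>_. L)" "S \<subseteq> T"
  shows "(\<Sum>\<alpha>\<in>PiE S (\<lambda>_. L). real (card (fibre S A \<alpha>))) = real (card A)"
  using sum_over_fibres[OF assms, of "\<lambda>_. 1"] by simp

lemma restrict_in_PiE:
  assumes "x \<in> PiE T (\<lambda>_. L)" "J \<subseteq> T"
  shows "restrict x J \<in> PiE J (\<lambda>_. L)"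
  using assms by auto

text \<open>
  The assumption \<open>ext\<close> says that fixing the coordinates in \<open>J\<close> does not raise the score by which
  a rectangle will be chosen. Summed over all \<open>\<beta>\<close> it gives, by Cauchy-Schwarz, a bound on the
  hits above one \<open>\<alpha>\<close> proportional to the square root of the fibre size. For a heavy fibre this square root
  is at most the fibre size divided by the root of the threshold, and the fibre sizes add up to
  \<open>card A\<close>. The powers of \<open>card L\<close> cancel, and one factor \<open>2 / t\<close> for each coordinate of \<open>J\<close> remains.
\<close>

lemma heavy_hits_le:
  fixes t :: real
  assumes T: "finite T" "finite L" "L \<noteq> {}"
    and AB: "A \<subseteq> PiE T (\<lambda>_. L)" "B \<subseteq> PiE T (\<lambda>_. L)" "A \<noteq> {}" "B \<noteq> {}"
    and J: "J \<subseteq> T" and t: "t > 0"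
    and ext: "\<And>\<alpha> \<beta>. real (hits g T z (fibre J A \<alpha>) (fibre J B \<beta>))
      \<le> real (hits g T z A B) / sqrt (real (card A) * real (card B)) * (2 * t / real (card L)) ^ card J
        * sqrt (real (card (fibre J A \<alpha>)) * real (card (fibre J B \<beta>)))"
  shows "real (hits g T z {x \<in> A. real (card (fibre J A (restrict x J)))
          > (t ^ 4 / real (card L)) ^ card J * real (card A)} B)
    \<le> (2 / t) ^ card J * real (hits g T z A B)"
proof -
  let ?N = "real (card L)" and ?j = "card J" and ?X = "PiE J (\<lambda>_. L)"
  let ?a = "\<lambda>\<alpha>. real (card (fibre J A \<alpha>))" and ?b = "\<lambda>\<beta>. real (card (fibre J B \<beta>))"
  define \<theta> where "\<theta> = (t ^ 4 / ?N) ^ ?j * real (card A)"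
  define Hv where "Hv = {\<alpha> \<in> ?X. ?a \<alpha> > \<theta>}"
  define \<Psi> where "\<Psi> = real (hits g T z A B) / sqrt (real (card A) * real (card B))"
  define \<kappa> where "\<kappa> = 2 * t / ?N"
  have fin: "finite A" "finite B" "finite J" "finite ?X"
    using T AB J by (auto intro!: finite_PiE elim!: finite_subset)
  have N: "?N > 0" using T by (simp add: card_gt_0_iff)
  have cA: "real (card A) > 0" and cB: "real (card B) > 0"
    using fin AB by (simp_all add: card_gt_0_iff)
  have \<theta>: "\<theta> > 0" using t N cA by (simp add: \<theta>_def)
  have \<Psi>: "\<Psi> \<ge> 0" "\<kappa> \<ge> 0" using t by (simp_all add: \<Psi>_def \<kappa>_def)
  have fHv: "finite Hv" using fin by (simp add: Hv_def)
  let ?E = "\<lambda>A B. {p \<in> A \<times> B. \<forall>i\<in>T. g (fst p i) (snd p i) = z i}"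
  let ?H = "{x \<in> A. ?a (restrict x J) > \<theta>}"
  have "?E ?H B \<subseteq> (\<Union>q\<in>Hv \<times> ?X. ?E (fibre J A (fst q)) (fibre J B (snd q)))"
  proof
    fix p assume p: "p \<in> ?E ?H B"
    then have p1: "fst p \<in> A" "snd p \<in> B" "?a (restrict (fst p) J) > \<theta>"
        "\<forall>i\<in>T. g (fst p i) (snd p i) = z i"
      unfolding mem_Collect_eq mem_Times_iff by - (elim conjE, assumption)+
    have X: "restrict (fst p) J \<in> ?X" "restrict (snd p) J \<in> ?X"
      by (rule restrict_in_PiE[OF subsetD[OF AB(1) p1(1)] J],
          rule restrict_in_PiE[OF subsetD[OF AB(2) p1(2)] J])
    show "p \<in> (\<Union>q\<in>Hv \<times> ?X. ?E (fibre J A (fst q)) (fibre J B (snd q)))"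
    proof (rule UN_I[of "(restrict (fst p) J, restrict (snd p) J)"])
      show "(restrict (fst p) J, restrict (snd p) J) \<in> Hv \<times> ?X"
        using X p1(3) by (simp only: Hv_def mem_Collect_eq mem_Times_iff fst_conv snd_conv)
      show "p \<in> ?E (fibre J A (fst (restrict (fst p) J, restrict (snd p) J)))
          (fibre J B (snd (restrict (fst p) J, restrict (snd p) J)))"
        using p1 by (simp only: fibre_def mem_Collect_eq mem_Times_iff fst_conv snd_conv)
    qed
  qed
  moreover have "finite (\<Union>q\<in>Hv \<times> ?X. ?E (fibre J A (fst q)) (fibre J B (snd q)))"
    using fin fHv by (intro finite_UN_I finite_cartesian_product finite_Collect_conjI disjI1)
      (auto simp: fibre_def)
  ultimately have "hits g T z ?H B \<le> card (\<Union>q\<in>Hv \<times> ?X. ?E (fibre J A (fst q)) (fibre J B (snd q)))"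
    unfolding hits_def by (intro card_mono)
  also have "\<dots> \<le> (\<Sum>q\<in>Hv \<times> ?X. hits g T z (fibre J A (fst q)) (fibre J B (snd q)))"
    unfolding hits_def by (rule card_UN_le) (use fin fHv in simp)
  finally have "real (hits g T z ?H B)
      \<le> (\<Sum>q\<in>Hv \<times> ?X. real (hits g T z (fibre J A (fst q)) (fibre J B (snd q))))"
    by (simp flip: of_nat_sum)
  also have "\<dots> \<le> (\<Sum>q\<in>Hv \<times> ?X. \<Psi> * \<kappa> ^ ?j * sqrt (?a (fst q) * ?b (snd q)))"
    unfolding \<Psi>_def \<kappa>_def by (intro sum_mono ext)
  also have "\<dots> = (\<Sum>\<alpha>\<in>Hv. \<Sum>\<beta>\<in>?X. \<Psi> * \<kappa> ^ ?j * (sqrt (?a \<alpha>) * sqrt (?b \<beta>)))"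
    by (simp add: sum.cartesian_product case_prod_unfold real_sqrt_mult)
  also have "\<dots> = \<Psi> * \<kappa> ^ ?j * ((\<Sum>\<alpha>\<in>Hv. sqrt (?a \<alpha>)) * (\<Sum>\<beta>\<in>?X. sqrt (?b \<beta>)))"
    unfolding sum_product by (simp only: sum_distrib_left)
  also have "\<dots> \<le> \<Psi> * \<kappa> ^ ?j * ((real (card A) / sqrt \<theta>) * sqrt (?N ^ ?j * real (card B)))"
  proof (intro mult_left_mono mult_mono)
    have "sqrt (?a \<alpha>) \<le> ?a \<alpha> / sqrt \<theta>" if "\<alpha> \<in> Hv" for \<alpha>
    proof -
      have "sqrt (?a \<alpha>) * sqrt \<theta> \<le> sqrt (?a \<alpha>) * sqrt (?a \<alpha>)"
        using that by (intro mult_left_mono) (auto simp: Hv_def)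
      then show ?thesis using \<theta> by (simp add: pos_le_divide_eq)
    qed
    then have "(\<Sum>\<alpha>\<in>Hv. sqrt (?a \<alpha>)) \<le> (\<Sum>\<alpha>\<in>Hv. ?a \<alpha> / sqrt \<theta>)"
      by (rule sum_mono)
    also have "\<dots> \<le> (\<Sum>\<alpha>\<in>?X. ?a \<alpha> / sqrt \<theta>)"
      using fin \<theta> by (intro sum_mono2) (auto simp: Hv_def)
    also have "\<dots> = real (card A) / sqrt \<theta>"
      using sum_card_fibre[OF T(1,2) AB(1) J] by (simp flip: sum_divide_distrib)
    finally show "(\<Sum>\<alpha>\<in>Hv. sqrt (?a \<alpha>)) \<le> real (card A) / sqrt \<theta>" .
    have "(\<Sum>\<beta>\<in>?X. 1 * sqrt (?b \<beta>))\<^sup>2 \<le> (\<Sum>\<beta>\<in>?X. 1\<^sup>2) * (\<Sum>\<beta>\<in>?X. (sqrt (?b \<beta>))\<^sup>2)"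
      by (rule Cauchy_Schwarz_ineq_sum)
    also have "\<dots> = ?N ^ ?j * real (card B)"
      using sum_card_fibre[OF T(1,2) AB(2) J] fin(3) by (simp add: card_PiE)
    finally show "(\<Sum>\<beta>\<in>?X. sqrt (?b \<beta>)) \<le> sqrt (?N ^ ?j * real (card B))"
      by (simp add: real_le_rsqrt)
  qed (use \<Psi> \<theta> in \<open>auto simp: sum_nonneg\<close>)
  also have "\<dots> = (2 / t) ^ ?j * real (hits g T z A B)"
  proof -
    let ?T = "(t\<^sup>2) ^ ?j" and ?sA = "sqrt (real (card A))" and ?sB = "sqrt (real (card B))"
      and ?sN = "sqrt (?N ^ ?j)"
    have "((t\<^sup>2) ^ ?j)\<^sup>2 = (t ^ 4) ^ ?j"
      by (simp add: mult_ac flip: power_mult)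
    then have "sqrt ((t ^ 4) ^ ?j) = ?T"
      by (intro real_sqrt_unique) auto
    then have s\<theta>: "sqrt \<theta> = ?T * ?sA / ?sN"
      by (simp add: \<theta>_def power_divide real_sqrt_mult real_sqrt_divide)
    have alg: "a / (T * u / v) * (v * r) = u * r * (P / T)"
      if "a = u * u" "P = v * v" "u > 0" "v > 0" "T > 0" for a T u v r P :: real
      using that by (simp add: field_simps)
    have "real (card A) / sqrt \<theta> * (?sN * ?sB) = ?sA * ?sB * (?N ^ ?j / ?T)"
      unfolding s\<theta> by (rule alg) (use N t cA in simp_all)
    moreover have "\<kappa> ^ ?j * (?N ^ ?j / ?T) = (2 / t) ^ ?j"
    proof -
      have "\<kappa> * (?N / t\<^sup>2) = 2 / t"
        using N t by (simp add: \<kappa>_def power2_eq_square)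
      then show ?thesis
        by (metis power_divide power_mult_distrib)
    qed
    moreover have "\<Psi> * (?sA * ?sB) = real (hits g T z A B)"
      using cA cB by (simp add: \<Psi>_def real_sqrt_mult)
    moreover have "P * k * q = w * r" if "q = u * v" "k * v = r" "P * u = w" for P k q w r u v :: real
      unfolding that(1) that(2,3)[symmetric] by simp
    ultimately have "\<Psi> * \<kappa> ^ ?j * (real (card A) / sqrt \<theta> * (?sN * ?sB))
        = real (hits g T z A B) * (2 / t) ^ ?j"
      by blast
    then show ?thesis
      by (simp only: real_sqrt_mult mult.commute[of "(2 / t) ^ ?j"])
  qed
  finally show ?thesis by (simp add: \<theta>_def)
qed

text \<open>
  The elements of \<open>A\<close> with a heavy fibre carry at most a quarter of the hits. Since passing to a
  subset of the rows does not raise the score either (assumption \<open>sub\<close>), the light elements, which carry at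
  least three quarters of the hits, must make up at least half of \<open>A\<close>. Hence the bound on the
  fibres of \<open>A\<close> turns into one relative to the size of the light part.
\<close>

lemma dense_part_exists:
  fixes t :: real
  assumes T: "finite T" "finite L" "L \<noteq> {}"
    and AB: "A \<subseteq> PiE T (\<lambda>_. L)" "B \<subseteq> PiE T (\<lambda>_. L)"
    and pos: "hits g T z A B > 0"
    and V: "V \<subseteq> T" and t: "t > 0" "(1 + 2 / t) ^ card V \<le> 5 / 4"
    and ext: "\<And>J \<alpha> \<beta>. J \<subseteq> V \<Longrightarrow> real (hits g T z (fibre J A \<alpha>) (fibre J B \<beta>))
      \<le> real (hits g T z A B) / sqrt (real (card A) * real (card B)) * (2 * t / real (card L)) ^ card J
        * sqrt (real (card (fibre J A \<alpha>)) * real (card (fibre J B \<beta>)))"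
    and sub: "\<And>A'. A' \<subseteq> A \<Longrightarrow>
      real (hits g T z A' B) * sqrt (real (card A)) \<le> real (hits g T z A B) * sqrt (real (card A'))"
  shows "\<exists>A'\<subseteq>A. A' \<noteq> {} \<and> spread (t ^ 4 / real (card L)) V A'"
proof -
  define heavy where "heavy J = {x \<in> A. real (card (fibre J A (restrict x J)))
          > (t ^ 4 / real (card L)) ^ card J * real (card A)}" for J
  let ?w = "\<lambda>C. real (hits g T z C B)"
  \<comment> \<open>The empty \<open>J\<close> is left out: its only fibre is \<open>A\<close> itself.\<close>
  define A' where "A' = A - (\<Union>J\<in>Pow V - {{}}. heavy J)"
  have fin: "finite A" "finite B"
    using T AB by (auto intro!: finite_PiE elim!: finite_subset)
  have fV: "finite V" using T V finite_subset by blast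
  have ne: "A \<noteq> {}" "B \<noteq> {}" using pos by (auto simp: hits_def)
  have "?w (\<Union>J\<in>Pow V - {{}}. heavy J) \<le> (\<Sum>J\<in>Pow V - {{}}. ?w (heavy J))"
    unfolding of_nat_sum[symmetric] of_nat_le_iff by (rule hits_UN_le) (use fV in simp)
  also have "\<dots> \<le> (\<Sum>J\<in>Pow V - {{}}. (2 / t) ^ card J * ?w A)"
    unfolding heavy_def using V by (intro sum_mono heavy_hits_le[OF T AB ne _ t(1)] ext) auto
  also have "\<dots> = ((\<Sum>J\<in>Pow V. (2 / t) ^ card J) - 1) * ?w A"
    using fV by (simp add: sum.remove[of _ "{}"] sum_distrib_right)
  also have "\<dots> \<le> 1 / 4 * ?w A"
    unfolding sum_power_card_Pow[OF fV] by (rule mult_right_mono) (use t(2) in simp_all)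
  finally have "?w (\<Union>J\<in>Pow V - {{}}. heavy J) \<le> 1 / 4 * ?w A" .
  moreover have "A = A' \<union> (\<Union>J\<in>Pow V - {{}}. heavy J)"
    by (auto simp: A'_def heavy_def)
  then have "?w A \<le> ?w A' + ?w (\<Union>J\<in>Pow V - {{}}. heavy J)"
    using hits_Un_le[of g T z A' "\<Union>J\<in>Pow V - {{}}. heavy J" B] by (simp flip: of_nat_add)
  ultimately have w: "?w A' \<ge> 3 / 4 * ?w A" by linarith
  have A': "A' \<subseteq> A" by (auto simp: A'_def)
  have "3 / 4 * ?w A * sqrt (real (card A)) \<le> ?w A' * sqrt (real (card A))"
    using w by (intro mult_right_mono) auto
  also have "\<dots> \<le> ?w A * sqrt (real (card A'))"
    by (rule sub[OF A'])
  finally have "3 / 4 * sqrt (real (card A)) \<le> sqrt (real (card A'))"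
    using pos by simp
  then have "(3 / 4 * sqrt (real (card A)))\<^sup>2 \<le> (sqrt (real (card A')))\<^sup>2"
    by (intro power_mono) auto
  then have half: "real (card A) \<le> 2 * real (card A')"
    by (simp add: power_mult_distrib power2_eq_square)
  have neA': "A' \<noteq> {}" using half ne fin by (auto simp: card_gt_0_iff)
  have fA': "finite A'" using A' fin finite_subset by blast
  have "real (card (fibre S A' \<alpha>)) \<le> 2 * (t ^ 4 / real (card L)) ^ card S * real (card A')"
    if S: "S \<subseteq> V" for S \<alpha>
  proof (cases "S = {} \<or> fibre S A' \<alpha> = {}")
    case True
    have "card (fibre S A' \<alpha>) \<le> card A'"
      using fA' by (intro card_mono) (auto simp: fibre_def)
    then show ?thesis using True t(1) by auto
  next
    case False
    then obtain x where x: "x \<in> A'" "restrict x S = \<alpha>" by (auto simp: fibre_def)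
    have "card (fibre S A' \<alpha>) \<le> card (fibre S A \<alpha>)"
      using fin A' by (intro card_mono) (auto simp: fibre_def)
    also have "real (card (fibre S A \<alpha>)) \<le> (t ^ 4 / real (card L)) ^ card S * real (card A)"
      using x S False by (auto simp: A'_def heavy_def not_less)
    also have "\<dots> \<le> (t ^ 4 / real (card L)) ^ card S * (2 * real (card A'))"
      using half t(1) by (intro mult_left_mono) auto
    finally show ?thesis by (simp add: mult_ac)
  qed
  then have "spread (t ^ 4 / real (card L)) V A'"
    by (simp add: spread_def)
  with A' neA' show ?thesis by blast
qed

section \<open>Large rectangles contain small certificates\<close>

text \<open>
  The rectangle is chosen to maximise \<open>score\<close> among all sub-rectangles that fix some coordinates in
  agreement with \<open>z\<close>. The size of \<open>I\<close> is bounded because every fixed coordinate must have gained a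
  factor \<open>t\<close> in the density of hits, while \<open>corr_bound_const\<close> caps what a rectangle of given side
  sizes can contain. That the free coordinates can take every value follows from maximality:
  \<open>dense_part_exists\<close> yields a spread sub-rectangle, on which all nontrivial characters of the free coordinates together are smaller than
  the main term.
\<close>

lemma small_certificate:
  fixes t \<delta> :: real and A0 B0 :: "('i \<Rightarrow> 'a) set"
  assumes T: "finite T" "finite L" "L \<noteq> {}"
    and A0: "A0 \<subseteq> PiE T (\<lambda>_. L)" and B0: "B0 \<subseteq> PiE T (\<lambda>_. L)"
    and box: "box_sum L (sgn_mat g) \<le> (\<delta> * card L) ^ 4" and \<delta>: "\<delta> \<ge> 0" and t: "t > 0"
    and small: "(1 + \<delta>) ^ card T \<le> 9 / 8" "(1 + 2 / t) ^ card T \<le> 5 / 4"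
      "(1 + t ^ 4 * \<delta>) ^ card T \<le> 5 / 4"
    and pos: "hits g T z A0 B0 > 0"
  obtains I where "I \<subseteq> T"
    "t ^ card I * (2 ^ card T * real (hits g T z A0 B0)) \<le> 9 / 8 * (real (card L) ^ card T)\<^sup>2"
    "\<And>z'. (\<And>i. i \<in> I \<Longrightarrow> z' i = z i) \<Longrightarrow> \<exists>x\<in>A0. \<exists>y\<in>B0. \<forall>i\<in>T. g (x i) (y i) = z' i"
proof -
  let ?N = "real (card L)"
  define \<kappa> where "\<kappa> = 2 * t / ?N"
  define adm where "adm I A B \<longleftrightarrow> I \<subseteq> T \<and> A \<subseteq> A0 \<and> B \<subseteq> B0 \<and> fixes_coords I A \<and> fixes_coords I B
    \<and> (\<forall>x\<in>A. \<forall>y\<in>B. \<forall>i\<in>I. g (x i) (y i) = z i)" for I A B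
  \<comment> \<open>The factor \<open>2 / ?N\<close> in \<open>\<kappa>\<close> normalises: fixing a block on both sides divides the number
    of hits by about \<open>?N\<^sup>2 / 2\<close> and the geometric mean of the sides by about \<open>?N\<close>. The factor \<open>t\<close> is the
    price of a fixed coordinate.\<close>
  define score where "score I A B
    = real (hits g T z A B) / (\<kappa> ^ card I * sqrt (real (card A) * real (card B)))"
    for I :: "'i set" and A B
  have N: "?N > 0" using T by (simp add: card_gt_0_iff)
  have \<kappa>: "\<kappa> > 0" using N t by (simp add: \<kappa>_def)
  have fin0: "finite A0" "finite B0"
    using T A0 B0 by (auto intro!: finite_PiE elim!: finite_subset)
  let ?S = "{(I, A, B). adm I A B}"
  have "?S \<subseteq> Pow T \<times> Pow A0 \<times> Pow B0" by (auto simp: adm_def)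
  then have finS: "finite ?S"
    by (rule finite_subset) (use T fin0 in simp)
  have start: "adm {} A0 B0" by (simp add: adm_def fixes_coords_def)
  have "Max ((\<lambda>(I, A, B). score I A B) ` ?S) \<in> (\<lambda>(I, A, B). score I A B) ` ?S"
    using finS start by (intro Max_in) auto
  then obtain I A B where adm: "adm I A B"
      and M: "score I A B = Max ((\<lambda>(I, A, B). score I A B) ` ?S)"
    by auto
  have max: "score I' A' B' \<le> score I A B" if "adm I' A' B'" for I' A' B'
    unfolding M using finS that by (intro Max_ge) force+
  have I: "I \<subseteq> T" and sub0: "A \<subseteq> A0" "B \<subseteq> B0" and fx: "fixes_coords I A" "fixes_coords I B"
    and agree: "\<And>x y i. x \<in> A \<Longrightarrow> y \<in> B \<Longrightarrow> i \<in> I \<Longrightarrow> g (x i) (y i) = z i"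
    using adm by (auto simp: adm_def)
  have AB: "A \<subseteq> PiE T (\<lambda>_. L)" "B \<subseteq> PiE T (\<lambda>_. L)" using sub0 A0 B0 by auto
  have fin: "finite A" "finite B" using sub0 fin0 finite_subset by auto
  let ?V = "T - I"
  have V: "?V \<subseteq> T" "finite ?V" using T by auto
  have cV: "card ?V + card I = card T"
    using I T by (simp add: card_Diff_subset card_mono finite_subset)
  have le_n: "c ^ card ?V \<le> c ^ card T" if "c \<ge> 1" for c :: real
    using that cV by (intro power_increasing) auto
  have ne0: "A0 \<noteq> {}" "B0 \<noteq> {}" using pos by (auto simp: hits_def)
  have c0: "real (card A0) > 0" "real (card B0) > 0" using ne0 fin0 by (simp_all add: card_gt_0_iff)
  have "0 < score {} A0 B0" using pos c0 by (simp add: score_def)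
  also have "\<dots> \<le> score I A B" by (rule max[OF start])
  finally have posI: "score I A B > 0" .
  then have w: "hits g T z A B > 0" by (cases "hits g T z A B = 0") (auto simp: score_def)
  then have ne: "A \<noteq> {}" "B \<noteq> {}" by (auto simp: hits_def)
  have c: "real (card A) > 0" "real (card B) > 0" using ne fin by (simp_all add: card_gt_0_iff)

  have size: "t ^ card I * (2 ^ card T * real (hits g T z A0 B0)) \<le> 9 / 8 * (?N ^ card T)\<^sup>2"
  proof -
    have "{p \<in> A \<times> B. \<forall>i\<in>T. g (fst p i) (snd p i) = z i}
        = {p \<in> A \<times> B. \<forall>i\<in>?V. g (fst p i) (snd p i) = z i}"
      using agree by (auto simp: mem_Times_iff)
    then have "2 ^ card ?V * real (hits g T z A B) = 2 ^ card ?V * real (hits g ?V z A B)"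
      by (simp add: hits_def)
    also have "\<dots> \<le> (\<Sum>S\<in>Pow ?V. \<bar>corr g S A B\<bar>)"
      by (rule hits_le_corr[OF V(2) fin])
    also have "\<dots> \<le> (\<Sum>S\<in>Pow ?V. sqrt (real (card A) * real (card B)) * ?N ^ card ?V * \<delta> ^ card S)"
      by (intro sum_mono corr_bound_const[OF T(1,2) AB I _ fx box \<delta>]) auto
    also have "\<dots> = sqrt (real (card A) * real (card B)) * ?N ^ card ?V * (1 + \<delta>) ^ card ?V"
      by (simp only: sum_power_card_Pow[OF V(2)] flip: sum_distrib_left)
    also have "\<dots> \<le> sqrt (real (card A) * real (card B)) * ?N ^ card ?V * (9 / 8)"
      using le_n[of "1 + \<delta>"] \<delta> small(1) by (intro mult_left_mono) auto
    finally have "real (hits g T z A B) \<le> sqrt (real (card A) * real (card B)) * (?N ^ card ?V * (9 / 8) / 2 ^ card ?V)"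
      by (simp add: field_simps)
    then have "score I A B \<le> ?N ^ card ?V * (9 / 8) / 2 ^ card ?V / \<kappa> ^ card I"
      using c \<kappa> by (simp add: score_def divide_simps mult_ac)
    then have "score {} A0 B0 \<le> ?N ^ card ?V * (9 / 8) / 2 ^ card ?V / \<kappa> ^ card I"
      using max[OF start] by linarith
    also have "\<dots> = 9 / 8 * ?N ^ (card ?V + card I) / (2 ^ (card ?V + card I) * t ^ card I)"
      using N by (simp add: \<kappa>_def power_divide power_mult_distrib power_add)
    finally have "real (hits g T z A0 B0) / sqrt (real (card A0) * real (card B0))
        \<le> 9 / 8 * ?N ^ card T / (2 ^ card T * t ^ card I)"
      by (simp add: cV score_def)
    then have "t ^ card I * (2 ^ card T * real (hits g T z A0 B0))
        \<le> 9 / 8 * ?N ^ card T * sqrt (real (card A0) * real (card B0))"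
      using c0 t by (simp add: divide_simps mult_ac)
    also have "sqrt (real (card A0) * real (card B0)) \<le> ?N ^ card T"
    proof (rule real_le_lsqrt)
      have "card A0 \<le> card L ^ card T" "card B0 \<le> card L ^ card T"
        using card_mono[OF _ A0] card_mono[OF _ B0] T by (simp_all add: card_PiE finite_PiE)
      then have "card A0 * card B0 \<le> card L ^ card T * card L ^ card T"
        by (rule mult_le_mono)
      then show "real (card A0) * real (card B0) \<le> (?N ^ card T)\<^sup>2"
        by (simp add: power2_eq_square flip: of_nat_mult of_nat_power)
    qed simp
    finally show ?thesis using N by (simp add: power2_eq_square)
  qed

  have ext: "real (hits g T z (fibre J A \<alpha>) (fibre J B \<beta>))
      \<le> real (hits g T z A B) / sqrt (real (card A) * real (card B)) * (2 * t / ?N) ^ card J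
        * sqrt (real (card (fibre J A \<alpha>)) * real (card (fibre J B \<beta>)))" if J: "J \<subseteq> ?V" for J \<alpha> \<beta>
  proof (cases "hits g T z (fibre J A \<alpha>) (fibre J B \<beta>) = 0")
    case True
    then show ?thesis using t by simp
  next
    case False
    let ?A = "fibre J A \<alpha>" and ?B = "fibre J B \<beta>"
    have "{p \<in> ?A \<times> ?B. \<forall>i\<in>T. g (fst p i) (snd p i) = z i} \<noteq> {}"
      using False unfolding hits_def by (intro notI) simp
    then obtain p where "p \<in> {p \<in> ?A \<times> ?B. \<forall>i\<in>T. g (fst p i) (snd p i) = z i}"
      by blast
    then have p: "fst p \<in> ?A" "snd p \<in> ?B" and pz: "\<And>i. i \<in> T \<Longrightarrow> g (fst p i) (snd p i) = z i"
      by (simp_all add: mem_Times_iff)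
    have fibJ: "x i = x' i" if "x \<in> fibre J D \<gamma>" "x' \<in> fibre J D \<gamma>" "i \<in> J" for x x' i D and \<gamma> :: "'i \<Rightarrow> 'a"
    proof -
      have "restrict x J i = restrict x' J i" using that by (simp add: fibre_def)
      then show ?thesis using that by simp
    qed
    have sub: "?A \<subseteq> A" "?B \<subseteq> B" by (auto simp: fibre_def)
    \<comment> \<open>One hit in the fibres certifies agreement with \<open>z\<close> on \<open>J\<close> for all of them, as the
      blocks in \<open>J\<close> are constant there.\<close>
    have "adm (I \<union> J) ?A ?B"
      unfolding adm_def
    proof (intro conjI ballI)
      show "I \<union> J \<subseteq> T" "?A \<subseteq> A0" "?B \<subseteq> B0" using I J sub sub0 by auto
      show "fixes_coords (I \<union> J) ?A" "fixes_coords (I \<union> J) ?B"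
        using fx sub fibJ unfolding fixes_coords_def by blast+
      fix x y i assume x: "x \<in> ?A" and y: "y \<in> ?B" and i: "i \<in> I \<union> J"
      show "g (x i) (y i) = z i"
      proof (cases "i \<in> I")
        case True then show ?thesis using agree x y sub by blast
      next
        case False
        then have "i \<in> J" using i by blast
        then have "x i = fst p i" "y i = snd p i" "i \<in> T"
          using fibJ[OF x p(1)] fibJ[OF y p(2)] J by auto
        then show ?thesis using pz by simp
      qed
    qed
    then have "score (I \<union> J) ?A ?B \<le> score I A B" by (rule max)
    moreover have "card (I \<union> J) = card I + card J"
      using I J T finite_subset by (intro card_Un_disjoint) auto
    moreover have "real (card ?A) > 0" "real (card ?B) > 0"
      using p fin sub finite_subset by (auto simp: card_gt_0_iff)
    ultimately have "real (hits g T z ?A ?B) / (\<kappa> ^ card I * \<kappa> ^ card J * sqrt (real (card ?A) * real (card ?B)))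
       \<le> real (hits g T z A B) / (\<kappa> ^ card I * sqrt (real (card A) * real (card B)))"
      and "sqrt (real (card ?A) * real (card ?B)) > 0"
      by (simp_all add: score_def power_add)
    moreover have "w' \<le> w / s * k * s'" if "w' / (i * k * s') \<le> w / (i * s)" "i > 0" "k > 0" "s > 0" "s' > 0"
      for w w' s s' i k :: real
      using that by (simp add: field_simps)
    ultimately show ?thesis
      using \<kappa> c unfolding \<kappa>_def[symmetric] by simp
  qed
  have subA: "real (hits g T z A' B) * sqrt (real (card A)) \<le> real (hits g T z A B) * sqrt (real (card A'))"
    if A': "A' \<subseteq> A" for A'
  proof (cases "A' = {}")
    case True then show ?thesis by (simp add: hits_def)
  next
    case False
    have "adm I A' B" using adm A' by (auto simp: adm_def fixes_coords_def subset_iff)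
    from max[OF this] show ?thesis
      using False A' fin(1) c \<kappa> finite_subset[OF A' fin(1)]
      by (simp add: score_def real_sqrt_mult divide_simps mult_ac card_gt_0_iff)
  qed
  have subB: "real (hits g T z A B') * sqrt (real (card B)) \<le> real (hits g T z A B) * sqrt (real (card B'))"
    if B': "B' \<subseteq> B" for B'
  proof (cases "B' = {}")
    case True then show ?thesis by (simp add: hits_def)
  next
    case False
    have "adm I A B'" using adm B' by (auto simp: adm_def fixes_coords_def subset_iff)
    from max[OF this] show ?thesis
      using False B' fin(2) c \<kappa> finite_subset[OF B' fin(2)]
      by (simp add: score_def real_sqrt_mult divide_simps mult_ac card_gt_0_iff)
  qed
  have small2: "(1 + 2 / t) ^ card ?V \<le> 5 / 4"
    by (rule order_trans[OF le_n small(2)]) (use t in simp)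
  have "\<exists>A'\<subseteq>A. A' \<noteq> {} \<and> spread (t ^ 4 / ?N) ?V A'"
    by (rule dense_part_exists[OF T AB w V(1) t small2 ext subA])
  then obtain A' where A': "A' \<subseteq> A" "A' \<noteq> {}" and dA: "spread (t ^ 4 / ?N) ?V A'"
    by blast
  have wB: "hits (\<lambda>x y. g y x) T z B A > 0" using w by (simp only: hits_swap[of g])
  have extB: "real (hits (\<lambda>x y. g y x) T z (fibre J B \<beta>) (fibre J A \<alpha>))
      \<le> real (hits (\<lambda>x y. g y x) T z B A) / sqrt (real (card B) * real (card A)) * (2 * t / ?N) ^ card J
        * sqrt (real (card (fibre J B \<beta>)) * real (card (fibre J A \<alpha>)))" if "J \<subseteq> ?V" for J \<alpha> \<beta>
    using ext[OF that, of \<alpha> \<beta>]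
    by (simp only: hits_swap[of g] mult.commute[of "real (card B)"] mult.commute[of "real (card (fibre J B \<beta>))"])
  have "\<exists>B'\<subseteq>B. B' \<noteq> {} \<and> spread (t ^ 4 / ?N) ?V B'"
    by (rule dense_part_exists[OF T AB(2,1) wB V(1) t small2 extB subB[folded hits_swap[of g]]])
  then obtain B' where B': "B' \<subseteq> B" "B' \<noteq> {}" and dB: "spread (t ^ 4 / ?N) ?V B'"
    by blast
  have fin': "finite A'" "finite B'" using A' B' fin finite_subset by auto
  have c': "real (card A') > 0" "real (card B') > 0" using A' B' fin' by (simp_all add: card_gt_0_iff)
  have corr: "\<bar>corr g S A' B'\<bar> \<le> 2 * (real (card A') * real (card B')) * (t ^ 4 * \<delta>) ^ card S" if S: "S \<subseteq> ?V" for S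
  proof -
    let ?c = "2 * (t ^ 4 / ?N) ^ card S"
    have "\<bar>corr g S A' B'\<bar> \<le> sqrt (?c * real (card A') * real (card A')) * sqrt (?c * real (card B') * real (card B'))
        * (\<delta> * ?N) ^ card S"
      using S A' B' AB box \<delta> dA dB by (intro corr_bound[OF T(1,2)]) (auto simp: spread_def)
    also have "sqrt (?c * real (card A') * real (card A')) = sqrt ?c * real (card A')"
      by (simp only: real_sqrt_mult mult.assoc) simp
    also have "sqrt (?c * real (card B') * real (card B')) = sqrt ?c * real (card B')"
      by (simp only: real_sqrt_mult mult.assoc) simp
    also have "sqrt ?c * real (card A') * (sqrt ?c * real (card B')) * (\<delta> * ?N) ^ card S
        = (sqrt ?c * sqrt ?c) * (real (card A') * real (card B')) * (\<delta> * ?N) ^ card S"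
      by (simp only: mult_ac)
    also have "sqrt ?c * sqrt ?c = ?c" using t by simp
    also have "?c * (real (card A') * real (card B')) * (\<delta> * ?N) ^ card S
        = 2 * (real (card A') * real (card B')) * (t ^ 4 / ?N * (\<delta> * ?N)) ^ card S"
      by (simp only: power_mult_distrib mult_ac)
    also have "t ^ 4 / ?N * (\<delta> * ?N) = t ^ 4 * \<delta>" using N by simp
    finally show ?thesis .
  qed
  have tot: "(\<Sum>S\<in>Pow ?V - {{}}. \<bar>corr g S A' B'\<bar>) \<le> real (card A') * real (card B') / 2"
  proof -
    have "(\<Sum>S\<in>Pow ?V - {{}}. \<bar>corr g S A' B'\<bar>)
        \<le> (\<Sum>S\<in>Pow ?V - {{}}. 2 * (real (card A') * real (card B')) * (t ^ 4 * \<delta>) ^ card S)"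
      by (intro sum_mono corr) auto
    also have "\<dots> = 2 * (real (card A') * real (card B')) * ((\<Sum>S\<in>Pow ?V. (t ^ 4 * \<delta>) ^ card S) - 1)"
      using V(2) by (simp add: sum.remove[of _ "{}"] sum_distrib_left)
    also have "\<dots> = 2 * (real (card A') * real (card B')) * ((1 + t ^ 4 * \<delta>) ^ card ?V - 1)"
      by (simp only: sum_power_card_Pow[OF V(2)])
    also have "\<dots> \<le> 2 * (real (card A') * real (card B')) * (1 / 4)"
      using le_n[of "1 + t ^ 4 * \<delta>"] \<delta> small(3) by (intro mult_left_mono) auto
    finally show ?thesis by simp
  qed
  show ?thesis
  proof (rule that[OF I size])
    fix z' assume z': "\<And>i. i \<in> I \<Longrightarrow> z' i = z i"
    have "2 ^ card ?V * real (hits g ?V z' A' B') \<ge> real (card A') * real (card B') / 2"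
      using hits_ge_corr[OF V(2) fin', of g z'] tot by linarith
    moreover have "real (card A') * real (card B') / 2 > 0"
      using c' by simp
    ultimately have "hits g ?V z' A' B' \<noteq> 0" by (intro notI) simp
    then have "{p \<in> A' \<times> B'. \<forall>i\<in>?V. g (fst p i) (snd p i) = z' i} \<noteq> {}"
      unfolding hits_def by (intro notI) simp
    then obtain p where "p \<in> {p \<in> A' \<times> B'. \<forall>i\<in>?V. g (fst p i) (snd p i) = z' i}"
      by blast
    then have p: "fst p \<in> A'" "snd p \<in> B'" "\<And>i. i \<in> ?V \<Longrightarrow> g (fst p i) (snd p i) = z' i"
      by (simp_all add: mem_Times_iff)
    have "\<forall>i\<in>T. g (fst p i) (snd p i) = z' i"
      using p agree z' A'(1) B'(1) by (metis DiffI subsetD)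
    then show "\<exists>x\<in>A0. \<exists>y\<in>B0. \<forall>i\<in>T. g (x i) (y i) = z' i"
      using p A'(1) B'(1) sub0 by blast
  qed
qed

text \<open>
  A gadget whose fourfold sum is small is nearly balanced, so no output string is much rarer than the
  others.
\<close>

lemma hits_all_ge:
  fixes \<delta> :: real
  assumes T: "finite T" "finite L"
    and box: "box_sum L (sgn_mat g) \<le> (\<delta> * card L) ^ 4" and \<delta>: "\<delta> \<ge> 0"
    and small: "(1 + \<delta>) ^ card T \<le> 9 / 8"
  shows "2 ^ card T * real (hits g T z (PiE T (\<lambda>_. L)) (PiE T (\<lambda>_. L))) \<ge> 7 / 8 * (real (card L) ^ card T)\<^sup>2"
proof -
  let ?P = "PiE T (\<lambda>_. L)" and ?N = "real (card L)"
  have fP: "finite ?P" using T by (intro finite_PiE) auto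
  have cP: "real (card ?P) = ?N ^ card T" using T by (simp add: card_PiE)
  have "(\<Sum>S\<in>Pow T - {{}}. \<bar>corr g S ?P ?P\<bar>) \<le> (\<Sum>S\<in>Pow T - {{}}. (?N ^ card T)\<^sup>2 * \<delta> ^ card S)"
  proof (rule sum_mono)
    fix S assume "S \<in> Pow T - {{}}"
    then have "\<bar>corr g S ?P ?P\<bar>
        \<le> sqrt (real (card ?P) * real (card ?P)) * ?N ^ card (T - {}) * \<delta> ^ card S"
      by (intro corr_bound_const[OF T _ _ _ _ _ _ box \<delta>]) (auto simp: fixes_coords_def)
    then show "\<bar>corr g S ?P ?P\<bar> \<le> (?N ^ card T)\<^sup>2 * \<delta> ^ card S"
      by (simp add: cP power2_eq_square)
  qed
  also have "\<dots> = (?N ^ card T)\<^sup>2 * ((\<Sum>S\<in>Pow T. \<delta> ^ card S) - 1)"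
    using T by (simp add: sum.remove[of _ "{}"] sum_distrib_left)
  also have "\<dots> \<le> (?N ^ card T)\<^sup>2 * (1 / 8)"
    unfolding sum_power_card_Pow[OF T(1)] using small by (intro mult_left_mono) auto
  finally show ?thesis
    using hits_ge_corr[OF T(1) fP fP, of g z] by (simp add: cP power2_eq_square)
qed

section \<open>From rectangle covers to certificates\<close>

text \<open>
  By the pigeonhole principle, one of at most \<open>2 ^ k\<close> rectangles contains at least a \<open>2 ^ - k\<close> fraction of the
  inputs mapped to \<open>z\<close>. The constants \<open>7 / 8\<close> and \<open>9 / 8\<close> cost less than one further factor 2.
\<close>

lemma certificate_from_cover:
  fixes t \<delta> :: real and A B :: "'r \<Rightarrow> ('i \<Rightarrow> 'a) set"
  assumes T: "finite T" "finite L" "L \<noteq> {}"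
    and rects: "\<And>R. R \<in> C \<Longrightarrow> A R \<subseteq> PiE T (\<lambda>_. L) \<and> B R \<subseteq> PiE T (\<lambda>_. L)"
    and C: "finite C" "card C \<le> 2 ^ k"
    and cover: "\<And>x y. x \<in> PiE T (\<lambda>_. L) \<Longrightarrow> y \<in> PiE T (\<lambda>_. L) \<Longrightarrow> \<forall>i\<in>T. g (x i) (y i) = z i
      \<Longrightarrow> \<exists>R\<in>C. x \<in> A R \<and> y \<in> B R"
    and box: "box_sum L (sgn_mat g) \<le> (\<delta> * card L) ^ 4" and \<delta>: "\<delta> \<ge> 0" and t: "t > 0"
    and small: "(1 + \<delta>) ^ card T \<le> 9 / 8" "(1 + 2 / t) ^ card T \<le> 5 / 4"
      "(1 + t ^ 4 * \<delta>) ^ card T \<le> 5 / 4"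
  obtains R I where "R \<in> C" "I \<subseteq> T" "t ^ card I \<le> 2 ^ Suc k"
    "\<And>z'. (\<And>i. i \<in> I \<Longrightarrow> z' i = z i) \<Longrightarrow> \<exists>x\<in>A R. \<exists>y\<in>B R. \<forall>i\<in>T. g (x i) (y i) = z' i"
proof -
  let ?P = "PiE T (\<lambda>_. L)" and ?M = "(real (card L) ^ card T)\<^sup>2"
  let ?all = "hits g T z ?P ?P" and ?h = "\<lambda>R. hits g T z (A R) (B R)"
  have M: "?M > 0" using T by (simp add: card_gt_0_iff)
  have all: "2 ^ card T * real ?all \<ge> 7 / 8 * ?M"
    by (rule hits_all_ge[OF T(1,2) box \<delta> small(1)])
  then have pos: "?all > 0"
    using M by (cases "?all = 0") auto
  let ?E = "\<lambda>A B. {p \<in> A \<times> B. \<forall>i\<in>T. g (fst p i) (snd p i) = z i}"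
  have fin: "finite (A R)" "finite (B R)" if "R \<in> C" for R
    using rects[OF that] T by (auto intro!: finite_PiE elim!: finite_subset)
  have "?E ?P ?P \<subseteq> (\<Union>R\<in>C. ?E (A R) (B R))"
  proof
    fix p assume "p \<in> ?E ?P ?P"
    then have p: "fst p \<in> ?P" "snd p \<in> ?P" "\<forall>i\<in>T. g (fst p i) (snd p i) = z i"
      unfolding mem_Collect_eq mem_Times_iff by - (elim conjE, assumption)+
    obtain R where "R \<in> C" "fst p \<in> A R" "snd p \<in> B R"
      using cover[OF p] by blast
    with p(3) show "p \<in> (\<Union>R\<in>C. ?E (A R) (B R))"
      by (intro UN_I[of R]) (simp_all add: mem_Times_iff)
  qed
  moreover have "finite (\<Union>R\<in>C. ?E (A R) (B R))"
    using C(1) fin by (intro finite_UN_I) auto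
  ultimately have "?all \<le> card (\<Union>R\<in>C. ?E (A R) (B R))"
    unfolding hits_def by (intro card_mono)
  also have "\<dots> \<le> (\<Sum>R\<in>C. ?h R)"
    unfolding hits_def by (rule card_UN_le[OF C(1)])
  finally have sum: "?all \<le> (\<Sum>R\<in>C. ?h R)" .
  have "\<exists>R\<in>C. ?all \<le> 2 ^ k * ?h R"
  proof (rule ccontr)
    assume "\<not> ?thesis"
    then have "\<And>R. R \<in> C \<Longrightarrow> 2 ^ k * ?h R < ?all" by (simp add: not_le)
    moreover have "C \<noteq> {}" using sum pos by auto
    ultimately have "(\<Sum>R\<in>C. 2 ^ k * ?h R) < (\<Sum>R\<in>C. ?all)"
      by (intro sum_strict_mono C(1))
    also have "\<dots> \<le> 2 ^ k * ?all" using C(2) by simp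
    finally show False using sum by (simp flip: sum_distrib_left)
  qed
  then obtain R where R: "R \<in> C" "?all \<le> 2 ^ k * ?h R" by blast
  then have hR: "?h R > 0" using pos by (cases "?h R = 0") auto
  obtain I where I: "I \<subseteq> T" "t ^ card I * (2 ^ card T * real (?h R)) \<le> 9 / 8 * ?M"
      "\<And>z'. (\<And>i. i \<in> I \<Longrightarrow> z' i = z i) \<Longrightarrow> \<exists>x\<in>A R. \<exists>y\<in>B R. \<forall>i\<in>T. g (x i) (y i) = z' i"
    using small_certificate[OF T conjunct1[OF rects[OF R(1)]] conjunct2[OF rects[OF R(1)]] box \<delta> t small hR]
    by blast
  have "real ?all \<le> real (2 ^ k * ?h R)"
    using R(2) by (rule of_nat_mono)
  then have "real ?all \<le> 2 ^ k * real (?h R)"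
    by simp
  then have "2 ^ card T * real ?all \<le> 2 ^ card T * (2 ^ k * real (?h R))"
    by (rule mult_left_mono) simp
  also have "\<dots> = 2 ^ k * (2 ^ card T * real (?h R))"
    by (rule mult.left_commute)
  finally have "7 / 8 * ?M \<le> 2 ^ k * (2 ^ card T * real (?h R))"
    using all by linarith
  then have "t ^ card I * (7 / 8 * ?M) \<le> t ^ card I * (2 ^ k * (2 ^ card T * real (?h R)))"
    using t by (intro mult_left_mono) auto
  also have "\<dots> = 2 ^ k * (t ^ card I * (2 ^ card T * real (?h R)))"
    by (simp only: mult_ac)
  also have "\<dots> \<le> 2 ^ k * (9 / 8 * ?M)"
    by (rule mult_left_mono[OF I(2)]) simp
  also have "\<dots> \<le> 2 ^ Suc k * (7 / 8 * ?M)"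
    using M by simp
  finally have "t ^ card I \<le> 2 ^ Suc k"
    using M by (simp only: mult_le_cancel_right)
  then show ?thesis
    using that[OF R(1) I(1)] I(3) by blast
qed

section \<open>Bit strings as concatenated blocks and as certificates\<close>

lemma finite_bits: "finite (bits n)"
  using finite_lists_length_eq[of "UNIV :: bool set" n] by (simp add: bits_def)

lemma C0_le_certificate_size:
  assumes cert: "\<And>z. z \<in> bits n \<Longrightarrow> \<not> f z \<Longrightarrow>
    \<exists>I\<subseteq>{..<n}. card I \<le> m \<and> (\<forall>z'\<in>bits n. (\<forall>i\<in>I. z' ! i = z ! i) \<longrightarrow> \<not> f z')"
  shows "C0 n f \<le> m"
proof -
  let ?Z = "{z \<in> bits n. \<not> f z}"
  have "\<forall>z\<in>?Z. \<exists>I\<subseteq>{..<n}. card I \<le> m \<and> (\<forall>z'\<in>bits n. (\<forall>i\<in>I. z' ! i = z ! i) \<longrightarrow> \<not> f z')"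
    using cert by blast
  then obtain I where "\<forall>z\<in>?Z. I z \<subseteq> {..<n} \<and> card (I z) \<le> m
      \<and> (\<forall>z'\<in>bits n. (\<forall>i\<in>I z. z' ! i = z ! i) \<longrightarrow> \<not> f z')"
    by (rule exE[OF bchoice])
  then have I: "\<And>z. z \<in> ?Z \<Longrightarrow> I z \<subseteq> {..<n}" "\<And>z. z \<in> ?Z \<Longrightarrow> card (I z) \<le> m"
      "\<And>z z'. z \<in> ?Z \<Longrightarrow> z' \<in> bits n \<Longrightarrow> \<forall>i\<in>I z. z' ! i = z ! i \<Longrightarrow> \<not> f z'"
    by blast+
  define lit where "lit z i = (if z ! i then Pos i else Neg i)" for z i
  define clause where "clause z = map (lit z) (sorted_list_of_set (I z))" for z
  have lit: "sat_literal z' (lit z i) \<longleftrightarrow> z' ! i = z ! i" "var (lit z i) = i" for z z' i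
    by (simp_all add: lit_def)
  have fI: "finite (I z)" if "z \<in> ?Z" for z
    using I(1)[OF that] finite_subset by blast
  obtain zs where zs: "set zs = ?Z"
    using finite_list[of ?Z] finite_bits by auto
  have sat: "(\<forall>a\<in>set (clause z). sat_literal z' a) \<longleftrightarrow> (\<forall>i\<in>I z. z' ! i = z ! i)" if "z \<in> ?Z" for z z'
    using fI[OF that] by (simp add: clause_def lit)
  have "is_dnf n m (map clause zs)"
    unfolding is_dnf_def
  proof
    fix c assume "c \<in> set (map clause zs)"
    then obtain z where z: "z \<in> ?Z" "c = clause z" using zs by auto
    show "length c \<le> m \<and> (\<forall>a\<in>set c. var a < n)"
      using I(1,2)[OF z(1)] fI[OF z(1)] by (auto simp: z(2) clause_def lit)
  qed
  moreover have "\<not> f x \<longleftrightarrow> sat_dnf x (map clause zs)" if x: "x \<in> bits n" for x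
  proof -
    have "sat_dnf x (map clause zs) \<longleftrightarrow> (\<exists>z\<in>?Z. \<forall>a\<in>set (clause z). sat_literal x a)"
      unfolding sat_dnf_def set_map zs by blast
    also have "\<dots> \<longleftrightarrow> (\<exists>z\<in>?Z. \<forall>i\<in>I z. x ! i = z ! i)"
      by (rule bex_cong[OF refl sat])
    also have "\<dots> \<longleftrightarrow> \<not> f x"
      using x I(3) by blast
    finally show ?thesis by simp
  qed
  ultimately show ?thesis
    unfolding C0_def C1_def by (intro Least_le) blast
qed

definition join_blocks :: "nat \<Rightarrow> (nat \<Rightarrow> bool list) \<Rightarrow> bool list" where
  "join_blocks n x = concat (map x [0..<n])"

lemma length_concat_blocks:
  assumes "\<And>j. j < m \<Longrightarrow> length (x j) = l"
  shows "length (concat (map x [0..<m])) = m * l"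
  using assms by (induction m) auto

lemma join_in_bits:
  assumes "x \<in> PiE {..<n} (\<lambda>_. bits l)"
  shows "join_blocks n x \<in> bits (l * n)"
  using assms length_concat_blocks[of n x l]
  by (auto simp: join_blocks_def bits_def mult.commute)

lemma block_join:
  assumes "x \<in> PiE {..<n} (\<lambda>_. bits l)" "i < n"
  shows "block l i (join_blocks n x) = x i"
proof -
  have len: "length (x j) = l" if "j < n" for j
    using assms(1) that by (auto simp: bits_def)
  have pre: "length (concat (map x [0..<i])) = i * l"
    using len assms(2) by (intro length_concat_blocks) simp
  have "[0..<n] = [0..<i] @ i # [Suc i..<n]"
    using assms(2) upt_add_eq_append[of 0 i "n - i"] by (simp add: upt_conv_Cons)
  then have "join_blocks n x = concat (map x [0..<i]) @ x i @ concat (map x [Suc i..<n])"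
    by (simp add: join_blocks_def)
  then show ?thesis
    using pre len[OF assms(2)] by (simp add: block_def)
qed

lemma gadget_pow_join:
  assumes "x \<in> PiE {..<n} (\<lambda>_. bits l)" "y \<in> PiE {..<n} (\<lambda>_. bits l)"
    and "z \<in> bits n" "\<And>i. i < n \<Longrightarrow> g (x i) (y i) = z ! i"
  shows "gadget_pow l n g (join_blocks n x) (join_blocks n y) = z"
  using assms by (intro nth_equalityI) (simp_all add: gadget_pow_def bits_def block_join)

lemma coNPcc_rect_cover:
  assumes "finite L"
  obtains C where "rect_cover L (\<lambda>x y. \<not> F x y) C" "card C \<le> 2 ^ coNPcc L F"
proof -
  let ?N = "\<lambda>x y. \<not> F x y"
  have "\<exists>P. protocol_for L ?N P \<and> cost P = bool_rank L ?N"
    unfolding protocol_iff_bool_rank[OF assms] by (rule less_imp_le[OF less_exp])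
  then have "\<exists>P. protocol_for L ?N P \<and> cost P = coNPcc L F"
    unfolding coNPcc_def NPcc_def by (rule LeastI)
  then obtain P where P: "protocol_for L ?N P" "cost P = coNPcc L F" by blast
  obtain C where C: "rect_cover L (has_accepting P) C" "card C \<le> 2 ^ cost P"
    using protocol_imp_rect_cover by blast
  have "rect_cover L ?N C"
    by (rule rect_cover_cong[OF C(1)]) (use P(1) in \<open>auto simp: protocol_for_def\<close>)
  then show ?thesis using that C(2) P(2) by simp
qed

text \<open>
  A rectangle in the cover consists of zeros of the composed function. Its certificate for \<open>z\<close>
  therefore forces \<open>f\<close> to vanish on the whole subcube, which is a clause of a DNF formula for the
  negation of \<open>f\<close>.
\<close>

lemma C0_le_coNPcc:
  fixes \<rho> \<delta> :: real
  assumes \<rho>: "\<rho> > 0"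
    and box: "box_sum (bits l) (sgn_mat g) \<le> (\<delta> * card (bits l)) ^ 4" and \<delta>: "\<delta> \<ge> 0"
    and small: "(1 + \<delta>) ^ n \<le> 9 / 8" "(1 + 2 / 2 powr \<rho>) ^ n \<le> 5 / 4"
      "(1 + (2 powr \<rho>) ^ 4 * \<delta>) ^ n \<le> 5 / 4"
  shows "\<rho> * real (C0 n f) \<le> real (coNPcc (bits (l * n)) (block_compose l n f g)) + 1"
proof -
  let ?F = "block_compose l n f g" and ?T = "{..<n}" and ?L' = "bits (l * n)"
  let ?P = "PiE ?T (\<lambda>_. bits l)"
  define k where "k = coNPcc ?L' ?F"
  define m where "m = nat \<lfloor>(real k + 1) / \<rho>\<rfloor>"
  obtain C where C: "rect_cover ?L' (\<lambda>x y. \<not> ?F x y) C" "card C \<le> 2 ^ k"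
    unfolding k_def by (rule coNPcc_rect_cover[OF finite_bits])
  have "\<forall>R\<in>C. \<exists>X. R = fst X \<times> snd X"
    using C(1) by (fastforce simp: rect_cover_def)
  then obtain X where X: "\<And>R. R \<in> C \<Longrightarrow> R = fst (X R) \<times> snd (X R)"
    by (metis bchoice)
  define A B where "A R = {x \<in> ?P. join_blocks n x \<in> fst (X R)}" and "B R = {y \<in> ?P. join_blocks n y \<in> snd (X R)}" for R
  have UC: "\<Union>C = ones ?L' (\<lambda>x y. \<not> ?F x y)" and fC: "finite C"
    using C(1) by (auto simp: rect_cover_def)
  have L: "finite (bits l)" "bits l \<noteq> {}"
    using finite_bits length_replicate[of l True] by (auto simp: bits_def simp del: length_replicate)
  have "C0 n f \<le> m"
  proof (rule C0_le_certificate_size)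
    fix z assume z: "z \<in> bits n" "\<not> f z"
    have cover: "\<exists>R\<in>C. x \<in> A R \<and> y \<in> B R"
      if xy: "x \<in> ?P" "y \<in> ?P" "\<forall>i\<in>?T. g (x i) (y i) = z ! i" for x y
    proof -
      have "gadget_pow l n g (join_blocks n x) (join_blocks n y) = z"
        using xy z by (intro gadget_pow_join) auto
      then have "(join_blocks n x, join_blocks n y) \<in> \<Union>C"
        using z(2) join_in_bits[OF xy(1)] join_in_bits[OF xy(2)]
        unfolding UC by (simp add: ones_def block_compose_def)
      then obtain R where R: "R \<in> C" "(join_blocks n x, join_blocks n y) \<in> R" by blast
      then have "(join_blocks n x, join_blocks n y) \<in> fst (X R) \<times> snd (X R)" using X[OF R(1)] by simp
      then show ?thesis using R(1) xy by (intro bexI[of _ R]) (auto simp: A_def B_def)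
    qed
    obtain R I where R: "R \<in> C" and I: "I \<subseteq> ?T" and le: "(2 powr \<rho>) ^ card I \<le> 2 ^ Suc k"
      and ex: "\<And>z'. (\<And>i. i \<in> I \<Longrightarrow> z' i = z ! i) \<Longrightarrow> \<exists>x\<in>A R. \<exists>y\<in>B R. \<forall>i\<in>?T. g (x i) (y i) = z' i"
    proof (rule certificate_from_cover[of ?T "bits l" C A B k g "\<lambda>i. z ! i" \<delta> "2 powr \<rho>"])
      show "A R \<subseteq> ?P \<and> B R \<subseteq> ?P" for R by (auto simp: A_def B_def)
    qed (use L fC C(2) cover box \<delta> small in simp_all)
    have "2 powr (\<rho> * real (card I)) \<le> 2 powr (real k + 1)"
      using le by (simp add: powr_powr[symmetric] powr_realpow powr_add mult.commute)
    then have "real (card I) \<le> (real k + 1) / \<rho>"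
      using \<rho> by (simp add: pos_le_divide_eq mult.commute)
    then have "card I \<le> m"
      unfolding m_def by (rule le_nat_floor)
    moreover have "\<not> f z'" if z': "z' \<in> bits n" "\<forall>i\<in>I. z' ! i = z ! i" for z'
    proof -
      obtain x y where xy: "x \<in> A R" "y \<in> B R" "\<forall>i\<in>?T. g (x i) (y i) = z' ! i"
        using ex[of "\<lambda>i. z' ! i"] z'(2) by blast
      then have P: "x \<in> ?P" "y \<in> ?P" and "(join_blocks n x, join_blocks n y) \<in> fst (X R) \<times> snd (X R)"
        by (auto simp: A_def B_def)
      then have "(join_blocks n x, join_blocks n y) \<in> \<Union>C"
        using X[OF R] R by blast
      moreover have "gadget_pow l n g (join_blocks n x) (join_blocks n y) = z'"
        using P xy(3) z'(1) by (intro gadget_pow_join) auto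
      ultimately show ?thesis
        unfolding UC by (simp add: ones_def block_compose_def)
    qed
    ultimately show "\<exists>I\<subseteq>?T. card I \<le> m \<and> (\<forall>z'\<in>bits n. (\<forall>i\<in>I. z' ! i = z ! i) \<longrightarrow> \<not> f z')"
      using I by blast
  qed
  then have "real (C0 n f) \<le> (real k + 1) / \<rho>"
    using \<rho> by (simp add: m_def le_nat_iff le_floor_iff)
  then show ?thesis
    using \<rho> by (simp add: k_def pos_le_divide_eq mult.commute)
qed

section \<open>Choice of parameters\<close>

lemma one_plus_small_power_le:
  fixes u :: real
  assumes "u \<ge> 0" "real n * u \<le> 1 / 16"
  shows "(1 + u) ^ n \<le> 9 / 8"
proof -
  have "(1 + u) ^ n \<le> exp u ^ n"
    using assms(1) by (intro power_mono) auto
  also have "\<dots> = exp (real n * u)"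
    by (simp add: exp_of_nat_mult)
  also have "\<dots> \<le> exp (1 / 16)"
    using assms(2) by simp
  also have "\<dots> \<le> 9 / 8"
    using exp_bound[of "1 / 16"] by (simp add: power2_eq_square)
  finally show ?thesis .
qed

theorem theorem3p2:
  "\<exists>K::real. K > 0 \<and> (\<forall>\<eta>::real. \<eta> > 0 \<longrightarrow> (\<exists>c::real. c > 0 \<and>
    (\<forall>(l::nat) (n::nat) (g :: bool list \<Rightarrow> bool list \<Rightarrow> bool).
      n \<ge> 2 \<longrightarrow> real l \<ge> c * log 2 (real n) \<longrightarrow>
      disc (bits l) g \<le> 2 powr (- \<eta> * real l) \<longrightarrow>
      (\<forall>f :: bool list \<Rightarrow> bool.
        real (coNPcc (bits (l * n)) (block_compose l n f g)) \<ge> K * (\<eta> * real (C0 n f) * real l)))))"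
proof (rule exI[of _ "1 / 64 :: real"], intro conjI allI impI)
  fix \<eta> :: real assume \<eta>: "\<eta> > 0"
  show "\<exists>c::real. c > 0 \<and>
    (\<forall>(l::nat) (n::nat) (g :: bool list \<Rightarrow> bool list \<Rightarrow> bool).
      n \<ge> 2 \<longrightarrow> real l \<ge> c * log 2 (real n) \<longrightarrow>
      disc (bits l) g \<le> 2 powr (- \<eta> * real l) \<longrightarrow>
      (\<forall>f :: bool list \<Rightarrow> bool.
        real (coNPcc (bits (l * n)) (block_compose l n f g)) \<ge> 1 / 64 * (\<eta> * real (C0 n f) * real l)))"
  proof (rule exI[of _ "224 / \<eta>"], intro conjI allI impI)
    show "224 / \<eta> > 0" using \<eta> by simp
  next
    fix l n :: nat and g :: "bool list \<Rightarrow> bool list \<Rightarrow> bool" and f :: "bool list \<Rightarrow> bool"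
    assume n: "n \<ge> 2" and l: "real l \<ge> 224 / \<eta> * log 2 (real n)"
      and disc: "disc (bits l) g \<le> 2 powr (- \<eta> * real l)"
    \<comment> \<open>With these values \<open>\<delta> ^ 4 = 4 * 2 powr (- \<eta> * l)\<close>, so \<open>t = 2 powr \<rho>\<close> satisfies
      \<open>t ^ 4 * \<delta> = 2 powr (1 / 2 - 4 * \<rho>)\<close>, well below \<open>1 / n\<close> once \<open>t\<close> is a large multiple of \<open>n\<close>.\<close>
    define \<rho> where "\<rho> = \<eta> * real l / 32"
    define \<delta> :: real where "\<delta> = 2 powr (1 / 2 - 8 * \<rho>)"
    define k where "k = coNPcc (bits (l * n)) (block_compose l n f g)"
    have log: "log 2 (real n) \<ge> 1" using n by (simp add: le_log_iff)
    have "\<eta> * real l \<ge> 224 * log 2 (real n)"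
      using l \<eta> by (simp add: pos_divide_le_eq mult.commute)
    then have \<rho>: "\<rho> \<ge> 6 + log 2 (real n)" "\<rho> \<ge> 7"
      using log by (simp_all add: \<rho>_def)
    have "64 * real n = 2 powr (6 + log 2 (real n))"
      using n by (simp add: powr_add)
    also have "\<dots> \<le> 2 powr \<rho>" using \<rho>(1) by simp
    finally have t: "64 * real n \<le> 2 powr \<rho>" .
    have e1: "real n * (2 / 2 powr \<rho>) \<le> 1 / 16"
      using t by (simp add: field_simps)
    have two: "2 / 2 powr \<rho> = 2 powr (1 - \<rho>)"
      by (simp add: powr_diff)
    have e2: "real n * \<delta> \<le> 1 / 16"
    proof -
      have "\<delta> \<le> 2 / 2 powr \<rho>"
        unfolding two \<delta>_def using \<rho>(2) by (intro powr_mono) auto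
      then have "real n * \<delta> \<le> real n * (2 / 2 powr \<rho>)" by (rule mult_left_mono) simp
      then show ?thesis using e1 by linarith
    qed
    have e3: "real n * ((2 powr \<rho>) ^ 4 * \<delta>) \<le> 1 / 16"
    proof -
      have "(2 powr \<rho>) ^ 4 * \<delta> = 2 powr (1 / 2 - 4 * \<rho>)"
        by (simp add: \<delta>_def powr_power flip: powr_add)
      also have "\<dots> \<le> 2 / 2 powr \<rho>"
        unfolding two using \<rho>(2) by (intro powr_mono) auto
      finally have "real n * ((2 powr \<rho>) ^ 4 * \<delta>) \<le> real n * (2 / 2 powr \<rho>)" by (rule mult_left_mono) simp
      then show ?thesis using e1 by linarith
    qed
    have \<delta>4: "\<delta> ^ 4 = 4 * 2 powr (- \<eta> * real l)"
    proof -
      have "\<delta> ^ 4 = 2 powr (2 + - \<eta> * real l)"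
        by (simp add: \<delta>_def \<rho>_def powr_power)
      then show ?thesis by (simp only: powr_add) simp
    qed
    have L: "finite (bits l)" "bits l \<noteq> {}"
      using finite_bits length_replicate[of l True] by (auto simp: bits_def simp del: length_replicate)
    have "box_sum (bits l) (sgn_mat g) \<le> 4 * disc (bits l) g * real (card (bits l)) ^ 4"
      by (rule box_le_disc[OF L])
    also have "\<dots> \<le> \<delta> ^ 4 * real (card (bits l)) ^ 4"
      unfolding \<delta>4 using disc by (intro mult_right_mono) auto
    finally have box: "box_sum (bits l) (sgn_mat g) \<le> (\<delta> * real (card (bits l))) ^ 4"
      by (simp add: power_mult_distrib)
    have main: "\<rho> * real (C0 n f) \<le> real k + 1"
      unfolding k_def
    proof (rule C0_le_coNPcc[OF _ box])
      show "\<rho> > 0" "\<delta> \<ge> 0" using \<rho> by (simp_all add: \<delta>_def)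
      show "(1 + \<delta>) ^ n \<le> 9 / 8"
        by (rule one_plus_small_power_le[OF _ e2]) (simp add: \<delta>_def)
      have "(1 + 2 / 2 powr \<rho>) ^ n \<le> 9 / 8"
        by (rule one_plus_small_power_le[OF _ e1]) simp
      then show "(1 + 2 / 2 powr \<rho>) ^ n \<le> 5 / 4" by linarith
      have "(1 + (2 powr \<rho>) ^ 4 * \<delta>) ^ n \<le> 9 / 8"
        by (rule one_plus_small_power_le[OF _ e3]) (simp add: \<delta>_def)
      then show "(1 + (2 powr \<rho>) ^ 4 * \<delta>) ^ n \<le> 5 / 4" by linarith
    qed
    have "7 * real (C0 n f) \<le> \<rho> * real (C0 n f)"
      using \<rho>(2) by (intro mult_right_mono) auto
    \<comment> \<open>The additive 1 can be absorbed into a factor 2 only if \<open>k \<ge> 1\<close>; for \<open>k = 0\<close> it is harmless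
      because \<open>C0 n f\<close> is an integer below 1.\<close>
    then have "C0 n f = 0" if "k = 0"
      using main that by simp
    then have "\<rho> * real (C0 n f) \<le> 2 * real k"
      using main by (cases "k = 0") auto
    then show "real (coNPcc (bits (l * n)) (block_compose l n f g)) \<ge> 1 / 64 * (\<eta> * real (C0 n f) * real l)"
      by (simp add: \<rho>_def k_def mult_ac)
  qed
qed simp

end
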